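(* Let $d_n=n(n+1)(n+2)$ and let $\varPsi$ be the unitarily invariant norm on $C(\mathbb{S}^n)$ defined by $$\varPsi(f)=\big(\varPsi_1^4(f)+\varPsi_2^4(Tf)\big)^{1/4},\qquad f\in C(\mathbb{S}^n),$$ where $T(f)=f-\int_{\mathbb{S}^n}f\,d\sigma$, $\varPsi_1(\cdot)=\sqrt[4]{3d_n}\,\lVert\cdot\rVert_{L^4}$ and $\varPsi_2(\cdot)=\sqrt[4]{n\,d_n}\,\lVert\cdot\rVert_{L^4}$. Then the weakly unitarily invariant norm $N_\varPsi$ on $M_n(\mathbb{C})$ induced by $\varPsi$ satisfies, for all $A\in M_n(\mathbb{C})$, \begin{align*} N_\varPsi^4(A)=\ &4\lVert A^2\rVert_F^2+2\lVert A\rVert_{(4)}^4+2\lVert A\rVert_F^4+\frac4n\,\Re\Big[\mathrm{tr}(A^2)\big[\mathrm{tr}A^\star\big]^2\Big]+\frac8n\lVert A\rVert_F^2\,|\mathrm{tr}(A)|^2\\ &+|\mathrm{tr}(A^2)|^2+\frac{3n-6}{n^2}\,|\mathrm{tr}(A)|^4. \end{align*}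
   Context: $\mathbb{S}^n$ is the unit sphere of $\mathbb{C}^n$, $\sigma$ the normalized Euclidean surface measure on it, $C(\mathbb{S}^n)$ the space of continuous complex functions on $\mathbb{S}^n$, and $L^4=L^4(\mathbb{S}^n,\sigma)$. A norm $\Phi$ on $C(\mathbb{S}^n)$ is unitarily invariant if $\Phi(f)=\Phi(f\circ U)$ for all $f\in C(\mathbb{S}^n)$ and all unitary $U$. The norm on $M_n(\mathbb{C})$ induced by such a $\Phi$ is $A\mapsto\Phi(f_A)$, where $f_A(\xi)=\langle A\xi,\xi\rangle$ for $\xi\in\mathbb{S}^n$; it is weakly unitarily invariant, i.e. invariant under $A\mapsto UAU^\star$ for unitary $U$. Thus $N_\varPsi(A)=\varPsi(f_A)$. $\lVert\cdot\rVert_F$ is the Frobenius norm, $\lVert A\rVert_{(4)}=[\mathrm{tr}(|A|^4)]^{1/4}$ with $|A|=\sqrt{A^\star A}$ is the Schatten 4-norm, $A^\star$ is the conjugate transpose, $\Re$ the real part. *)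

theory Defs
  imports "HOL-Analysis.Analysis"
begin

definition cinner :: "complex^'n \<Rightarrow> complex^'n \<Rightarrow> complex" where
  "cinner x y = (\<Sum>i\<in>UNIV. x $ i * cnj (y $ i))"

definition ctranspose :: "complex^'n^'n \<Rightarrow> complex^'n^'n" where
  "ctranspose A = (\<chi> i j. cnj (A $ j $ i))"

definition unitary_mat :: "complex^'n^'n \<Rightarrow> bool" where
  "unitary_mat U \<longleftrightarrow> ctranspose U ** U = mat 1 \<and> U ** ctranspose U = mat 1"

definition psd_mat :: "complex^'n^'n \<Rightarrow> bool" where
  "psd_mat B \<longleftrightarrow> ctranspose B = B \<and> (\<forall>x. 0 \<le> Re (cinner (B *v x) x))"

definition mat_abs :: "complex^'n^'n \<Rightarrow> complex^'n^'n" where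
  "mat_abs A = (THE B. psd_mat B \<and> B ** B = ctranspose A ** A)"

definition frobenius_norm :: "complex^'n^'n \<Rightarrow> real" where
  "frobenius_norm A = sqrt (\<Sum>i\<in>UNIV. \<Sum>j\<in>UNIV. (cmod (A $ i $ j))\<^sup>2)"

text \<open>The trace of the fourth power of \<open>mat_abs A\<close> is real and nonnegative, so passing to \<open>Re\<close>
  only changes its type.\<close>

definition schatten4_norm :: "complex^'n^'n \<Rightarrow> real" where
  "schatten4_norm A = root 4 (Re (trace (mat_abs A ** mat_abs A ** mat_abs A ** mat_abs A)))"

text \<open>The Euclidean surface measure in polar coordinates: the measure of a Borel set \<open>E\<close> of the
  sphere is the real dimension of the ambient space (here \<open>2 * CARD('n)\<close>) times the Lebesgue
  measure of the cone consisting of all \<open>r *\<^sub>R x\<close> with \<open>0 < r \<le> 1\<close> and \<open>x \<in> E\<close>.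
  This cone is the preimage of \<open>E\<close> in the punctured ball under
  \<open>sgn x = x /\<^sub>R norm x\<close>.\<close>

definition surface_measure :: "(complex^'n) measure" where
  "surface_measure =
     scale_measure (of_nat DIM(complex^'n))
       (distr (restrict_space lborel (cball 0 1 - {0})) (restrict_space borel (sphere 0 1)) sgn)"

definition sigma_sphere :: "(complex^'n) measure" where
  "sigma_sphere = uniform_measure surface_measure (sphere 0 1)"

text \<open>Elements of \<open>C_sphere\<close> are total functions of which only the values on the sphere matter.
  Two of them with the same values there represent the same continuous function on the sphere;
  the axioms of \<open>unitarily_invariant_norm\<close> below force a norm to identify them.\<close>

definition C_sphere :: "(complex^'n \<Rightarrow> complex) set" where
  "C_sphere = {f. continuous_on (sphere 0 1) f}"

definition unitarily_invariant_norm :: "((complex^'n \<Rightarrow> complex) \<Rightarrow> real) \<Rightarrow> bool" where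
  "unitarily_invariant_norm \<Phi> \<longleftrightarrow>
     (\<forall>f\<in>C_sphere. 0 \<le> \<Phi> f) \<and>
     (\<forall>f\<in>C_sphere. \<Phi> f = 0 \<longleftrightarrow> (\<forall>\<xi>\<in>sphere 0 1. f \<xi> = 0)) \<and>
     (\<forall>f\<in>C_sphere. \<forall>c. \<Phi> (\<lambda>\<xi>. c * f \<xi>) = cmod c * \<Phi> f) \<and>
     (\<forall>f\<in>C_sphere. \<forall>g\<in>C_sphere. \<Phi> (\<lambda>\<xi>. f \<xi> + g \<xi>) \<le> \<Phi> f + \<Phi> g) \<and>
     (\<forall>f\<in>C_sphere. \<forall>U. unitary_mat U \<longrightarrow> \<Phi> f = \<Phi> (\<lambda>\<xi>. f (U *v \<xi>)))"

definition quad_fun :: "complex^'n^'n \<Rightarrow> complex^'n \<Rightarrow> complex" where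
  "quad_fun A \<xi> = cinner (A *v \<xi>) \<xi>"

definition induced_norm :: "((complex^'n \<Rightarrow> complex) \<Rightarrow> real) \<Rightarrow> complex^'n^'n \<Rightarrow> real" where
  "induced_norm \<Phi> A = \<Phi> (quad_fun A)"

text \<open>Matrices carry only real scalar multiplication in the library; the complex multiple of \<open>A\<close>
  by \<open>c\<close> is written \<open>mat c ** A\<close>.\<close>

definition weakly_unitarily_invariant_norm :: "(complex^'n^'n \<Rightarrow> real) \<Rightarrow> bool" where
  "weakly_unitarily_invariant_norm N \<longleftrightarrow>
     (\<forall>A. 0 \<le> N A) \<and>
     (\<forall>A. N A = 0 \<longleftrightarrow> A = 0) \<and>
     (\<forall>A c. N (mat c ** A) = cmod c * N A) \<and>
     (\<forall>A B. N (A + B) \<le> N A + N B) \<and>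
     (\<forall>A U. unitary_mat U \<longrightarrow> N (U ** A ** ctranspose U) = N A)"

definition L4_norm :: "(complex^'n \<Rightarrow> complex) \<Rightarrow> real" where
  "L4_norm f = root 4 (LINT \<xi>|sigma_sphere. cmod (f \<xi>) ^ 4)"

definition T_op :: "(complex^'n \<Rightarrow> complex) \<Rightarrow> complex^'n \<Rightarrow> complex" where
  "T_op f = (\<lambda>\<xi>. f \<xi> - (LINT \<eta>|sigma_sphere. f \<eta>))"

definition d_coeff :: "nat \<Rightarrow> real" where
  "d_coeff n = real (n * (n + 1) * (n + 2))"

definition Psi1 :: "(complex^'n \<Rightarrow> complex) \<Rightarrow> real" where
  "Psi1 f = root 4 (3 * d_coeff CARD('n)) * L4_norm f"

definition Psi2 :: "(complex^'n \<Rightarrow> complex) \<Rightarrow> real" where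
  "Psi2 f = root 4 (real CARD('n) * d_coeff CARD('n)) * L4_norm f"

definition Psi :: "(complex^'n \<Rightarrow> complex) \<Rightarrow> real" where
  "Psi f = root 4 (Psi1 f ^ 4 + Psi2 (T_op f) ^ 4)"

end

theory Submission
  imports Defs "HOL-Probability.Characteristic_Functions"
begin

text \<open>The surface measure is invariant under unitary maps because Lebesgue measure is, so for quadratic
  forms \<open>f\<^sub>i = quad_fun A\<^sub>i\<close> the derivative of
  \<open>\<integral> f\<^sub>1 f\<^sub>2 f\<^sub>3 f\<^sub>4 d\<sigma>\<close> along a one-parameter group of unitaries vanishes. Complexifying the
  generator and summing over all matrix units \<open>E\<^sub>b\<^sub>a\<close> with \<open>A\<^sub>1 = Z E\<^sub>a\<^sub>b\<close> turns this into the recursion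
  \<open>(n + 3) E[f\<^sub>Z f\<^sub>B f\<^sub>C f\<^sub>D] = tr Z E[f\<^sub>B f\<^sub>C f\<^sub>D] + E[f\<^sub>Z\<^sub>B f\<^sub>C f\<^sub>D] + E[f\<^sub>B f\<^sub>Z\<^sub>C f\<^sub>D] + E[f\<^sub>B f\<^sub>C f\<^sub>Z\<^sub>D]\<close>,
  which determines all moments up to order four as polynomials in traces of words. Lower moments are
  the special cases where some of the matrices are the identity. Since \<open>f\<^sub>I = 1\<close> on the sphere and the mean
  of \<open>f\<^sub>A\<close> is \<open>tr A / n\<close>, the formula for the norm follows by expanding \<open>\<bar>f\<^sub>A - tr A / n\<bar>\<^sup>4\<close>. The triangle
  inequality for \<open>Psi\<close> holds since \<open>Psi\<^sup>4\<close> is convex and homogeneous of degree four.\<close>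

section \<open>Unitary invariance of the surface measure\<close>

lemma emeasure_lborel_unit_ball_pos: "emeasure lborel (ball (0::'a::euclidean_space) 1) \<noteq> 0"
proof -
  have "unit_ball_vol (real DIM('a)) > 0" by (rule unit_ball_vol_pos) simp
  then have "ennreal (unit_ball_vol (real DIM('a))) \<noteq> 0" unfolding ennreal_eq_0_iff by linarith
  then show ?thesis by (simp add: emeasure_ball)
qed

text \<open>Uniqueness of Haar measure in convolution form: compare both measures with the unit ball, which
  \<open>T\<close> preserves, by evaluating one double integral in two ways.\<close>

lemma distr_lborel_orthogonal:
  fixes T :: "'a::euclidean_space \<Rightarrow> 'a"
  assumes T: "orthogonal_transformation T"
  shows "distr lborel borel T = lborel"
proof (rule measure_eqI)
  show "sets (distr lborel borel T) = sets (lborel :: 'a measure)" by simp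
  fix E assume "E \<in> sets (distr lborel borel T)"
  then have E[measurable]: "E \<in> sets borel" by simp
  define S where "S = inv T"
  have lT: "linear T" and lS: "orthogonal_transformation S"
    using T by (auto simp: S_def orthogonal_transformation_linear orthogonal_transformation_inv)
  have TS: "T (S x) = x" and ST: "S (T x) = x" for x
    using orthogonal_transformation_bij[OF T] by (simp_all add: S_def bij_is_inj bij_is_surj surj_f_inv_f)
  have [measurable]: "T \<in> borel_measurable borel"
    using lT by (intro borel_measurable_continuous_onI linear_continuous_on)
      (auto simp: linear_conv_bounded_linear)
  have shift: "(\<integral>\<^sup>+x. h (x + a) \<partial>lborel) = (\<integral>\<^sup>+x. h x \<partial>lborel)"
    if [measurable]: "h \<in> borel_measurable borel" for h :: "'a \<Rightarrow> ennreal" and a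
  proof -
    have "(\<integral>\<^sup>+x. h x \<partial>lborel) = (\<integral>\<^sup>+x. h x \<partial>distr lborel borel ((+) a))"
      by (simp add: lborel_distr_plus)
    also have "\<dots> = (\<integral>\<^sup>+x. h (x + a) \<partial>lborel)"
      by (subst nn_integral_distr) (auto simp: add.commute)
    finally show ?thesis by simp
  qed
  define f g where "f = (indicator (ball 0 1) :: 'a \<Rightarrow> ennreal)" and "g = (indicator E :: 'a \<Rightarrow> ennreal)"
  have [measurable]: "f \<in> borel_measurable borel" "g \<in> borel_measurable borel"
    by (auto simp: f_def g_def intro!: borel_measurable_indicator)
  let ?b = "emeasure lborel (ball (0::'a) 1)"
  have fb: "(\<integral>\<^sup>+y. f y \<partial>lborel) = ?b" and gE: "(\<integral>\<^sup>+y. g y \<partial>lborel) = emeasure lborel E"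
    by (simp_all add: f_def g_def)
  \<comment> \<open>Since \<open>T\<close> is isometric with inverse \<open>S\<close>, the point
    \<open>x - T y\<close> lies in the unit ball exactly when \<open>y\<close> lies in the unit ball
    around \<open>S x\<close>.\<close>
  have ball: "(\<integral>\<^sup>+y. f (x - T y) \<partial>lborel) = ?b" for x
  proof -
    have "norm (x - T y) = norm (y - S x)" for y
    proof -
      have "norm (x - T y) = norm (T (S x - y))" using linear_diff[OF lT] TS by simp
      then show ?thesis using orthogonal_transformation_norm[OF T] by (simp add: norm_minus_commute)
    qed
    then have "(\<integral>\<^sup>+y. f (x - T y) \<partial>lborel) = (\<integral>\<^sup>+y. f (y + - S x) \<partial>lborel)"
      by (intro nn_integral_cong) (auto simp: f_def indicator_def)
    also have "\<dots> = (\<integral>\<^sup>+y. f y \<partial>lborel)" by (rule shift) measurable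
    also have "\<dots> = ?b" by (rule fb)
    finally show ?thesis .
  qed
  have "?b * emeasure (distr lborel borel T) E = ?b * (\<integral>\<^sup>+y. g (T y) \<partial>lborel)"
  proof -
    have "emeasure (distr lborel borel T) E = (\<integral>\<^sup>+y. g y \<partial>distr lborel borel T)"
      by (simp add: g_def)
    then show ?thesis by (subst (asm) nn_integral_distr) auto
  qed
  also have "\<dots> = (\<integral>\<^sup>+x. f x * (\<integral>\<^sup>+y. g (T y) \<partial>lborel) \<partial>lborel)"
    by (subst nn_integral_multc) (auto simp: fb)
  \<comment> \<open>Translating \<open>y\<close> by \<open>S x\<close> replaces \<open>T y\<close>
    by \<open>x + T y\<close>. This couples the two variables, so that after interchanging the
    integrals a translation in \<open>x\<close> moves the dependence on \<open>T\<close> from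
    \<open>g\<close> to the ball.\<close>
  also have "\<dots> = (\<integral>\<^sup>+x. f x * (\<integral>\<^sup>+y. g (T (y + S x)) \<partial>lborel) \<partial>lborel)"
    by (subst shift[where h = "\<lambda>y. g (T y)"]) measurable
  also have "\<dots> = (\<integral>\<^sup>+x. (\<integral>\<^sup>+y. f x * g (x + T y) \<partial>lborel) \<partial>lborel)"
    by (subst nn_integral_cmult[symmetric]) (auto simp: linear_add[OF lT] TS add.commute)
  also have "\<dots> = (\<integral>\<^sup>+y. (\<integral>\<^sup>+x. f x * g (x + T y) \<partial>lborel) \<partial>lborel)"
    by (rule lborel_pair.Fubini') measurable
  also have "\<dots> = (\<integral>\<^sup>+y. (\<integral>\<^sup>+x. f (x - T y) * g x \<partial>lborel) \<partial>lborel)"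
  proof (rule nn_integral_cong)
    fix y
    show "(\<integral>\<^sup>+x. f x * g (x + T y) \<partial>lborel) = (\<integral>\<^sup>+x. f (x - T y) * g x \<partial>lborel)"
      using shift[of "\<lambda>x. f (x - T y) * g x" "T y"] by simp
  qed
  also have "\<dots> = (\<integral>\<^sup>+x. (\<integral>\<^sup>+y. f (x - T y) * g x \<partial>lborel) \<partial>lborel)"
    by (rule lborel_pair.Fubini') measurable
  also have "\<dots> = (\<integral>\<^sup>+x. ?b * g x \<partial>lborel)"
    by (subst nn_integral_multc) (auto simp: ball)
  also have "\<dots> = ?b * emeasure lborel E"
    by (subst nn_integral_cmult) (auto simp: gE)
  finally have eq: "?b * emeasure (distr lborel borel T) E = ?b * emeasure lborel E" .
  have "?b \<noteq> 0" "?b < \<infinity>"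
    by (simp_all only: emeasure_lborel_unit_ball_pos emeasure_lborel_ball_finite not_False_eq_True)
  then show "emeasure (distr lborel borel T) E = emeasure lborel E"
    using eq by (auto simp: ennreal_mult_cancel_left)
qed

section \<open>The Hermitian inner product, adjoints and unitary matrices\<close>

lemma cinner_self: "cinner x x = of_real ((norm x)\<^sup>2)"
  by (simp add: cinner_def norm_vec_def L2_set_def sum_nonneg complex_norm_square del: of_real_power)

lemma cinner_add_left: "cinner (x + y) z = cinner x z + cinner y z"
  by (simp add: cinner_def algebra_simps sum.distrib)

lemma cinner_add_right: "cinner x (y + z) = cinner x y + cinner x z"
  by (simp add: cinner_def algebra_simps sum.distrib)

lemma cinner_scale_left: "cinner (c *s x) y = c * cinner x y"
  by (simp add: cinner_def sum_distrib_left mult.assoc)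

lemma cinner_scale_right: "cinner x (c *s y) = cnj c * cinner x y"
  by (simp add: cinner_def sum_distrib_left algebra_simps)

lemma cnj_cinner: "cnj (cinner x y) = cinner y x"
  by (simp add: cinner_def mult.commute)

lemma cinner_adjoint: "cinner (A *v x) y = cinner x (ctranspose A *v y)"
  by (simp add: cinner_def ctranspose_def matrix_vector_mult_def sum_distrib_left sum_distrib_right mult_ac)
    (rule sum.swap)

lemma ctranspose_ctranspose [simp]: "ctranspose (ctranspose A) = A"
  by (simp add: ctranspose_def vec_eq_iff)

lemma ctranspose_mult: "ctranspose (A ** B) = ctranspose B ** ctranspose A"
  by (simp add: ctranspose_def vec_eq_iff matrix_matrix_mult_def mult.commute)

lemma ctranspose_diff: "ctranspose (A - B) = ctranspose A - ctranspose B"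
  by (simp add: ctranspose_def vec_eq_iff)

lemma ctranspose_mat: "ctranspose (mat c) = mat (cnj c)"
  by (simp add: ctranspose_def vec_eq_iff mat_def)

lemma trace_ctranspose: "trace (ctranspose A) = cnj (trace A)"
  by (simp add: trace_def ctranspose_def)

lemma unitary_mat_ctranspose: "unitary_mat U \<Longrightarrow> unitary_mat (ctranspose U)"
  by (simp add: unitary_mat_def)

lemma norm_unitary_mult:
  assumes "unitary_mat U" shows "norm (U *v x) = norm x"
proof -
  have "cinner (U *v x) (U *v x) = cinner x x"
    using assms by (simp add: cinner_adjoint matrix_vector_mul_assoc unitary_mat_def)
  then have "(norm (U *v x))\<^sup>2 = (norm x)\<^sup>2"
    unfolding cinner_self of_real_eq_iff .
  then show ?thesis by simp
qed

lemma linear_matrix_vector_mult_complex: "linear ((*v) (U :: complex^'n^'m))"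
  by (rule linearI) (simp_all add: vec_eq_iff matrix_vector_mult_def algebra_simps sum.distrib scaleR_sum_right)

lemma continuous_on_matrix_vector_mult:
  "continuous_on S f \<Longrightarrow> continuous_on S (\<lambda>x. (U :: complex^'n^'m) *v f x)"
  unfolding matrix_vector_mult_def by (intro continuous_intros)

lemma orthogonal_transformation_unitary:
  "unitary_mat U \<Longrightarrow> orthogonal_transformation ((*v) U)"
  by (simp add: orthogonal_transformation linear_matrix_vector_mult_complex norm_unitary_mult)

section \<open>The normalized surface measure through cones in the ball\<close>

abbreviation punctured_ball :: "(complex^'n) set" where
  "punctured_ball \<equiv> cball 0 1 - {0}"

lemma sgn_measurable_sphere:
  "sgn \<in> measurable (restrict_space lborel punctured_ball) (restrict_space borel (sphere (0::complex^'n) 1))"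
proof (rule measurable_restrict_space2)
  show "sgn \<in> space (restrict_space lborel punctured_ball) \<rightarrow> sphere (0::complex^'n) 1"
    by (auto simp: space_restrict_space norm_sgn)
  show "sgn \<in> borel_measurable (restrict_space lborel (punctured_ball :: (complex^'n) set))"
    by (intro measurable_restrict_space1) measurable
qed

lemma sets_sigma_sphere: "sets sigma_sphere = sets (restrict_space borel (sphere (0::complex^'n) 1))"
  by (simp add: sigma_sphere_def surface_measure_def)

lemma space_sigma_sphere [simp]: "space sigma_sphere = sphere (0::complex^'n) 1"
  using sets_eq_imp_space_eq[OF sets_sigma_sphere] by (simp add: space_restrict_space)

lemma emeasure_surface_measure:
  assumes "E \<in> sets (restrict_space borel (sphere (0::complex^'n) 1))"
  shows "emeasure surface_measure E =
    of_nat DIM(complex^'n) * emeasure lborel (sgn -` E \<inter> punctured_ball)"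
proof -
  have "sgn -` E \<inter> space (restrict_space lborel punctured_ball) \<in> sets (restrict_space lborel punctured_ball)"
    by (rule measurable_sets[OF sgn_measurable_sphere assms])
  then show ?thesis
    using assms by (simp add: surface_measure_def emeasure_distr[OF sgn_measurable_sphere]
      emeasure_restrict_space space_restrict_space)
qed

lemma sgn_vimage_sphere: "sgn -` sphere (0::complex^'n) 1 \<inter> punctured_ball = punctured_ball"
  by (auto simp: norm_sgn)

lemma surface_measure_sphere:
  "emeasure surface_measure (sphere (0::complex^'n) 1) \<noteq> 0"
  "emeasure surface_measure (sphere (0::complex^'n) 1) < \<infinity>"
proof -
  have "emeasure lborel (punctured_ball :: (complex^'n) set) = emeasure lborel (cball (0::complex^'n) 1)"
    by (subst emeasure_Diff) auto
  moreover have "sphere (0::complex^'n) 1 \<in> sets (restrict_space borel (sphere (0::complex^'n) 1))"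
    by (simp add: sets_restrict_space_iff)
  ultimately have *: "emeasure surface_measure (sphere (0::complex^'n) 1) =
    of_nat DIM(complex^'n) * emeasure lborel (cball (0::complex^'n) 1)"
    by (simp only: emeasure_surface_measure sgn_vimage_sphere)
  have "emeasure lborel (cball (0::complex^'n) 1) \<noteq> 0"
    using emeasure_lborel_unit_ball_pos[where 'a = "complex^'n"] emeasure_mono[OF ball_subset_cball, of 0 1 "lborel :: (complex^'n) measure"]
    by auto
  then show "emeasure surface_measure (sphere (0::complex^'n) 1) \<noteq> 0" 
    unfolding * by simp
  show "emeasure surface_measure (sphere (0::complex^'n) 1) < \<infinity>"
    unfolding * by (simp add: ennreal_mult_less_top emeasure_lborel_cball_finite[simplified] of_nat_less_top)
qed

text \<open>Reduces statements about the sphere to the Lebesgue measure of cones. Both unitary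
  invariance and the treatment of null sets rest on this.\<close>

lemma emeasure_sigma_sphere:
  assumes "E \<in> sets (restrict_space borel (sphere (0::complex^'n) 1))"
  shows "emeasure sigma_sphere E = of_nat DIM(complex^'n) *
    emeasure lborel (sgn -` E \<inter> punctured_ball) / emeasure surface_measure (sphere (0::complex^'n) 1)"
proof -
  have "E \<subseteq> sphere 0 1"
    using sets.sets_into_space[OF assms] by (simp add: space_restrict_space)
  then have "sphere 0 1 \<inter> E = E" by auto
  moreover have "sphere (0::complex^'n) 1 \<in> sets (restrict_space borel (sphere (0::complex^'n) 1))"
    by (simp add: sets_restrict_space_iff)
  ultimately show ?thesis
    using assms unfolding sigma_sphere_def
    by (subst emeasure_uniform_measure) (auto simp: surface_measure_def[THEN arg_cong[where f = sets]] emeasure_surface_measure)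
qed

interpretation sigma_sphere: prob_space "sigma_sphere :: (complex^'n) measure"
proof
  have *: "sphere (0::complex^'n) 1 \<in> sets (restrict_space borel (sphere (0::complex^'n) 1))"
    by (simp add: sets_restrict_space_iff)
  show "emeasure sigma_sphere (space (sigma_sphere :: (complex^'n) measure)) = 1"
    using surface_measure_sphere[where 'n='n]
    by (subst space_sigma_sphere, subst emeasure_sigma_sphere[OF *],
        subst emeasure_surface_measure[OF *, symmetric]) (rule ennreal_divide_self, auto)
qed

text \<open>A unitary map commutes with \<open>sgn\<close> and preserves the punctured ball, so the
  cone over the preimage of \<open>E\<close> is the preimage of the cone over \<open>E\<close>.
  Orthogonal invariance of Lebesgue measure then applies.\<close>

lemma distr_sigma_sphere_unitary:
  assumes U: "unitary_mat (U :: complex^'n^'n)"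
  shows "distr sigma_sphere sigma_sphere ((*v) U) = sigma_sphere"
proof (rule measure_eqI)
  show "sets (distr sigma_sphere sigma_sphere ((*v) U)) = sets (sigma_sphere :: (complex^'n) measure)" by simp
  have cU[measurable]: "(*v) U \<in> borel_measurable borel"
    by (intro borel_measurable_continuous_onI continuous_on_matrix_vector_mult continuous_on_id)
  have mU: "(*v) U \<in> measurable sigma_sphere sigma_sphere"
    unfolding measurable_cong_sets[OF sets_sigma_sphere sets_sigma_sphere]
    by (intro measurable_restrict_space3 cU) (auto simp: norm_unitary_mult[OF U])
  fix E assume "E \<in> sets (distr sigma_sphere sigma_sphere ((*v) U))"
  then have E': "E \<in> sets sigma_sphere" by simp
  then have E: "E \<in> sets (restrict_space borel (sphere (0::complex^'n) 1))"
    by (simp add: sets_sigma_sphere)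
  let ?F = "(*v) U -` E \<inter> sphere 0 1"
  have F: "?F \<in> sets (restrict_space borel (sphere (0::complex^'n) 1))"
    using measurable_sets[OF mU E'] by (simp add: sets_sigma_sphere)
  have sgnU: "sgn (U *v x) = U *v sgn x" for x
    by (simp add: sgn_div_norm norm_unitary_mult[OF U] linear_scale[OF linear_matrix_vector_mult_complex])
  have meas: "sgn -` E \<inter> punctured_ball \<in> sets borel"
    using measurable_sets[OF sgn_measurable_sphere E]
    by (simp add: sets_restrict_space_iff space_restrict_space)
  have nz: "U *v x = 0 \<longleftrightarrow> x = 0" for x
    using norm_unitary_mult[OF U, of x] norm_eq_zero by metis
  have "sgn -` ?F \<inter> punctured_ball = (*v) U -` (sgn -` E \<inter> punctured_ball)"
    by (auto simp: sgnU norm_unitary_mult[OF U] norm_sgn nz)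
  then have "emeasure lborel (sgn -` ?F \<inter> punctured_ball) =
      emeasure (distr lborel borel ((*v) U)) (sgn -` E \<inter> punctured_ball)"
    by (simp add: emeasure_distr meas)
  also have "\<dots> = emeasure lborel (sgn -` E \<inter> punctured_ball)"
    by (simp add: distr_lborel_orthogonal[OF orthogonal_transformation_unitary[OF U]])
  finally have eq: "emeasure lborel (sgn -` ?F \<inter> punctured_ball) = emeasure lborel (sgn -` E \<inter> punctured_ball)" .
  have "emeasure (distr sigma_sphere sigma_sphere ((*v) U)) E = emeasure sigma_sphere ?F"
    using emeasure_distr[OF mU E'] by simp
  then show "emeasure (distr sigma_sphere sigma_sphere ((*v) U)) E = emeasure sigma_sphere E"
    by (simp only: emeasure_sigma_sphere[OF E] emeasure_sigma_sphere[OF F] eq)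
qed

lemma borel_measurable_sigma_sphere:
  "continuous_on (sphere (0::complex^'n) 1) f \<Longrightarrow> f \<in> borel_measurable sigma_sphere"
  unfolding measurable_cong_sets[OF sets_sigma_sphere refl]
  by (rule borel_measurable_continuous_on_restrict)

lemma integrable_sigma_sphere:
  fixes f :: "complex^'n \<Rightarrow> 'b::{banach, second_countable_topology}"
  assumes "continuous_on (sphere 0 1) f"
  shows "integrable sigma_sphere f"
proof -
  have "compact (f ` sphere 0 1)"
    by (rule compact_continuous_image[OF assms]) simp
  then obtain B where "\<forall>x\<in>sphere 0 1. norm (f x) \<le> B"
    using compact_imp_bounded bounded_iff by (metis imageI)
  then show ?thesis
    by (intro sigma_sphere.integrable_const_bound[where B = B] borel_measurable_sigma_sphere assms) auto
qed

lemma integral_sigma_sphere_unitary: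
  fixes f :: "complex^'n \<Rightarrow> 'b::{banach, second_countable_topology}"
  assumes U: "unitary_mat U" and f: "continuous_on (sphere 0 1) f"
  shows "(LINT \<xi>|sigma_sphere. f (U *v \<xi>)) = (LINT \<xi>|sigma_sphere. f \<xi>)"
proof -
  have "(*v) U \<in> measurable sigma_sphere sigma_sphere"
    unfolding measurable_cong_sets[OF sets_sigma_sphere sets_sigma_sphere]
    by (intro measurable_restrict_space3 borel_measurable_continuous_onI
        continuous_on_matrix_vector_mult continuous_on_id) (auto simp: norm_unitary_mult[OF U])
  then show ?thesis
    using integral_distr[OF _ borel_measurable_sigma_sphere[OF f], of "(*v) U" sigma_sphere]
    by (simp add: distr_sigma_sphere_unitary[OF U])
qed

text \<open>The set where \<open>h\<close> is nonzero is null for \<open>sigma_sphere\<close>, hence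
  the cone over it is Lebesgue null. By continuity the part of that cone inside the open ball is
  open, so it cannot be both null and nonempty.\<close>

lemma integral_sigma_sphere_eq_0_imp:
  fixes h :: "complex^'n \<Rightarrow> real"
  assumes h: "continuous_on (sphere 0 1) h" and nonneg: "\<And>x. 0 \<le> h x"
    and int: "(LINT \<xi>|sigma_sphere. h \<xi>) = 0" and x: "x \<in> sphere 0 1"
  shows "h x = 0"
proof (rule ccontr)
  assume nx: "h x \<noteq> 0"
  let ?B = "ball (0::complex^'n) 1 - {0}"
  let ?O = "{y \<in> ?B. h (sgn y) \<in> - {0}}"
  let ?E = "{\<xi> \<in> space sigma_sphere. h \<xi> \<noteq> 0}"
  have mh: "h \<in> borel_measurable sigma_sphere"
    by (rule borel_measurable_sigma_sphere[OF h])
  have "?E = h -` (- {0}) \<inter> space sigma_sphere" by auto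
  also have "\<dots> \<in> sets sigma_sphere" by (rule measurable_sets[OF mh]) auto
  finally have E: "?E \<in> sets (restrict_space borel (sphere (0::complex^'n) 1))"
    by (simp add: sets_sigma_sphere)
  have "AE \<xi> in sigma_sphere. h \<xi> = 0"
    using integral_nonneg_eq_0_iff_AE[OF integrable_sigma_sphere[OF h]] nonneg int by simp
  then have E0: "emeasure sigma_sphere ?E = 0"
    using E by (subst (asm) AE_iff_measurable[OF _ refl]) (auto simp: sets_sigma_sphere)
  have "emeasure lborel (sgn -` ?E \<inter> punctured_ball) = 0"
    using E0 surface_measure_sphere[where 'n='n] unfolding emeasure_sigma_sphere[OF E]
    by (auto simp: ennreal_divide_eq_0_iff)
  moreover have "sgn -` ?E \<inter> punctured_ball \<in> sets borel"
    using measurable_sets[OF sgn_measurable_sphere E]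
    by (simp add: sets_restrict_space_iff space_restrict_space)
  ultimately have "sgn -` ?E \<inter> punctured_ball \<in> null_sets lborel" by auto
  then have "negligible (sgn -` ?E \<inter> punctured_ball)"
    by (simp add: negligible_iff_null_sets null_sets_completionI)
  then have neg: "negligible ?O"
    by (rule negligible_subset) (auto simp: norm_sgn)
  have "continuous_on ?B (\<lambda>y. h (sgn y))"
    by (rule continuous_on_compose2[OF h])
      (auto simp: norm_sgn split: if_splits intro!: continuous_intros)
  moreover have O_eq: "?O = ?B \<inter> (\<lambda>y. h (sgn y)) -` (- {0})" by auto
  ultimately have "open ?O"
    using continuous_open_preimage[of ?B "\<lambda>y. h (sgn y)" "- {0}"]
    unfolding O_eq by (simp add: open_Diff open_Compl)
  \<comment> \<open>Halving moves the boundary point \<open>x\<close> into the open ball without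
    changing its direction.\<close>
  moreover have "(1/2) *\<^sub>R x \<in> ?O"
    using x nx by (auto simp: sgn_div_norm)
  ultimately show False
    using open_not_negligible[of ?O] neg by blast
qed

section \<open>Hermitian matrices and the polar decomposition\<close>

lemma cinner_zero [simp]: "cinner 0 y = 0" "cinner x 0 = 0"
  by (simp_all add: cinner_def)

lemma cinner_diff_left: "cinner (x - y) z = cinner x z - cinner y z"
  by (simp add: cinner_def algebra_simps sum_subtractf)

lemma cinner_diff_right: "cinner x (y - z) = cinner x y - cinner x z"
  by (simp add: cinner_def algebra_simps sum_subtractf)

lemma matrix_vector_mult_scale: "(A :: complex^'n^'m) *v (c *s x) = c *s (A *v x)"
  by (simp add: vec_eq_iff matrix_vector_mult_def sum_distrib_left mult_ac)

lemma scaleR_eq_scale: "c *\<^sub>R (x :: complex^'n) = complex_of_real c *s x"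
  unfolding vec_eq_iff vector_scaleR_component vector_smult_component by (simp add: scaleR_conv_of_real)

lemma matrix_vector_mult_axis_complex: "((A :: complex^'n^'n) *v axis j 1) $ i = A $ i $ j"
  by (simp add: matrix_vector_mult_def axis_def if_distrib cong: if_cong)

lemma quad_fun_polarization:
  fixes A :: "complex^'n^'n"
  shows "4 * cinner (A *v x) y = quad_fun A (x + y) - quad_fun A (x - y)
    + \<i> * quad_fun A (x + \<i> *s y) - \<i> * quad_fun A (x - \<i> *s y)"
  by (simp add: quad_fun_def matrix_vector_right_distrib matrix_vector_mult_diff_distrib
      matrix_vector_mult_scale cinner_add_left cinner_add_right cinner_diff_left cinner_diff_right
      cinner_scale_left cinner_scale_right algebra_simps)

lemma cinner_axis_right: "cinner x (axis i 1) = x $ i"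
  by (simp add: cinner_def axis_def if_distrib cong: if_cong)

text \<open>By homogeneity the form vanishes everywhere, and polarization at pairs of axis vectors
  recovers each entry of \<open>A\<close>. This is what makes induced norms definite.\<close>

lemma quad_fun_eq_0_imp:
  fixes A :: "complex^'n^'n"
  assumes "\<And>\<xi>. \<xi> \<in> sphere 0 1 \<Longrightarrow> quad_fun A \<xi> = 0"
  shows "A = 0"
proof -
  have z: "quad_fun A x = 0" for x
  proof (cases "x = 0")
    case False
    then have "quad_fun A (inverse (norm x) *\<^sub>R x) = 0" by (intro assms) simp
    then show ?thesis
      using False by (simp add: quad_fun_def scaleR_eq_scale matrix_vector_mult_scale cinner_scale_left cinner_scale_right)
  qed (simp add: quad_fun_def)
  have "A $ i $ j = 0" for i j
    using quad_fun_polarization[of A "axis j 1" "axis i 1"]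
    by (simp add: z cinner_axis_right matrix_vector_mult_axis_complex)
  then show ?thesis by (simp add: vec_eq_iff)
qed

text \<open>The form of \<open>ctranspose A - A\<close> is the conjugate of the form of
  \<open>A\<close> minus that form, which is zero at real values.\<close>

lemma ctranspose_eq_selfI:
  fixes A :: "complex^'n^'n"
  assumes "\<And>x. x \<in> sphere 0 1 \<Longrightarrow> quad_fun A x \<in> \<real>"
  shows "ctranspose A = A"
proof -
  have "quad_fun (ctranspose A - A) x = cnj (quad_fun A x) - quad_fun A x" for x
    by (simp add: quad_fun_def matrix_vector_mult_diff_rdistrib cinner_diff_left cnj_cinner cinner_adjoint)
  then have "quad_fun (ctranspose A - A) x = 0" if "x \<in> sphere 0 1" for x
    using assms[OF that] by (simp add: Reals_cnj_iff)
  from quad_fun_eq_0_imp[OF this] show ?thesis by simp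
qed

lemma continuous_on_cinner [continuous_intros]:
  "continuous_on S f \<Longrightarrow> continuous_on S g \<Longrightarrow> continuous_on S (\<lambda>x. cinner (f x) (g x))"
  unfolding cinner_def by (intro continuous_intros)

lemma continuous_on_quad_fun: "continuous_on S (quad_fun A)"
  unfolding quad_fun_def
  by (intro continuous_intros continuous_on_matrix_vector_mult continuous_on_id)

text \<open>Move from \<open>x\<close> in the direction of \<open>y = P *v x\<close>: the form at
  \<open>x - t y\<close> equals -2 t a + t^2 b with a the squared norm of \<open>y\<close>. For
  small positive t this would be negative unless a = 0.\<close>

lemma psd_mat_eq_0:
  fixes P :: "complex^'n^'n"
  assumes P: "psd_mat P" and x: "Re (cinner (P *v x) x) = 0"
  shows "P *v x = 0"
proof -
  define y where "y = P *v x"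
  define a b where "a = (norm y)\<^sup>2" and "b = Re (cinner (P *v y) y)"
  have b0: "b \<ge> 0" using P by (simp add: b_def psd_mat_def)
  have "cinner (P *v y) x = cinner y y"
    using P by (simp add: psd_mat_def cinner_adjoint y_def)
  then have e: "Re (cinner (P *v (x - of_real t *s y)) (x - of_real t *s y)) = - (2 * t * a) + t\<^sup>2 * b" for t
    using x by (simp add: matrix_vector_mult_diff_distrib matrix_vector_mult_scale cinner_diff_left
      cinner_diff_right cinner_scale_left cinner_scale_right a_def b_def y_def[symmetric] cinner_self
      power2_eq_square algebra_simps)
  have "0 \<le> - (2 * t * a) + t\<^sup>2 * b" for t
    using P unfolding e[symmetric] by (simp add: psd_mat_def)
  note le = this
  have "a = 0"
  proof (rule ccontr)
    assume "a \<noteq> 0"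
    then have a: "a > 0" by (simp add: a_def)
    \<comment> \<open>This choice gives t b \<le> a, so the quadratic term is at most half of the
      linear one; the added 1 keeps the denominator positive when \<open>b\<close> is zero.\<close>
    define t where "t = a / (b + 1)"
    have t: "t > 0" "t * b \<le> a"
      using a b0 by (simp_all add: t_def field_simps)
    have "t\<^sup>2 * b \<le> t * a"
      using mult_left_mono[OF t(2), of t] t(1) by (simp add: power2_eq_square mult_ac)
    moreover have "t * a > 0" using t a by simp
    ultimately show False using le[of t] by linarith
  qed
  then show ?thesis by (simp add: a_def y_def)
qed

lemma hermitian_cinner: "ctranspose A = A \<Longrightarrow> cinner (A *v x) y = cinner x (A *v y)"
  by (metis cinner_adjoint)

lemma hermitian_quad_real: "ctranspose A = A \<Longrightarrow> quad_fun A x = of_real (Re (quad_fun A x))"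
  by (metis Reals_cnj_iff cnj_cinner hermitian_cinner of_real_Re quad_fun_def)

text \<open>If \<open>l\<close> is the maximum of the quadratic form on the sphere, attained at \<open>v\<close>, then \<open>mat l - D\<close> is positive
  semidefinite and its form vanishes at \<open>v\<close>.\<close>

lemma hermitian_max_eigenvector:
  fixes D :: "complex^'n^'n"
  assumes D: "ctranspose D = D" and pos: "Re (quad_fun D y) > 0"
  obtains v l where "v \<noteq> 0" "l > 0" "D *v v = l *\<^sub>R v"
proof -
  have "\<exists>v\<in>sphere (0::complex^'n) 1. \<forall>w\<in>sphere 0 1. Re (quad_fun D w) \<le> Re (quad_fun D v)"
    by (rule continuous_attains_sup) (auto intro!: continuous_intros continuous_on_quad_fun)
  then obtain v where v: "norm v = 1" and max: "\<And>w. norm w = 1 \<Longrightarrow> Re (quad_fun D w) \<le> Re (quad_fun D v)"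
    by auto
  define l where "l = Re (quad_fun D v)"
  have scale: "Re (quad_fun D (c *\<^sub>R x)) = c\<^sup>2 * Re (quad_fun D x)" for c x
    by (simp add: quad_fun_def scaleR_eq_scale matrix_vector_mult_scale cinner_scale_left
      cinner_scale_right power2_eq_square)
  have le: "Re (quad_fun D w) \<le> l * (norm w)\<^sup>2" for w
  proof (cases "w = 0")
    case False
    then have "Re (quad_fun D (inverse (norm w) *\<^sub>R w)) \<le> l"
      unfolding l_def by (intro max) simp
    then show ?thesis using False by (simp add: scale field_simps power2_eq_square)
  qed (simp add: quad_fun_def)
  have "l > 0"
  proof (rule ccontr)
    assume "\<not> l > 0"
    then have "l * (norm y)\<^sup>2 \<le> 0" by (simp add: mult_nonpos_nonneg)
    then show False using le[of y] pos by linarith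
  qed
  define P where "P = mat (of_real l) - D"
  have Pv: "P *v x = l *\<^sub>R x - D *v x" for x
  proof -
    have "mat (complex_of_real l) *v x = l *\<^sub>R x"
      by (simp add: scaleR_eq_scale vec_eq_iff matrix_vector_mult_def mat_def if_distrib if_distribR cong: if_cong)
    then show ?thesis by (simp add: P_def matrix_vector_mult_diff_rdistrib)
  qed
  have q: "Re (cinner (P *v x) x) = l * (norm x)\<^sup>2 - Re (quad_fun D x)" for x
    by (simp add: Pv quad_fun_def cinner_diff_left scaleR_eq_scale cinner_scale_left cinner_self del: of_real_power)
  have "psd_mat P"
    using D le unfolding psd_mat_def q by (simp add: P_def ctranspose_diff ctranspose_mat)
  moreover have "Re (cinner (P *v v) v) = 0"
    by (simp add: q v l_def)
  ultimately have "P *v v = 0" by (rule psd_mat_eq_0)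
  then have "D *v v = l *\<^sub>R v" by (simp add: Pv)
  moreover have "v \<noteq> 0" using v by auto
  ultimately show thesis using \<open>l > 0\<close> that by blast
qed

text \<open>Otherwise \<open>B - C\<close> has an eigenvector \<open>v\<close> with eigenvalue l >
  0. Equal squares give \<open>B *v v\<close> and \<open>C *v v\<close> the same norm, and inserting
  Bv = Cv + lv yields l (<Bv,v> + <Cv,v>) = 0 in real parts. Both forms then vanish at
  \<open>v\<close>, so Bv = Cv = 0, contradicting lv \<noteq> 0.\<close>

lemma psd_mat_sqrt_diff_nonpos:
  fixes B C :: "complex^'n^'n"
  assumes B: "psd_mat B" and C: "psd_mat C" and eq: "B ** B = C ** C"
  shows "Re (quad_fun (B - C) y) \<le> 0"
proof (rule ccontr)
  assume "\<not> ?thesis"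
  then have pos: "Re (quad_fun (B - C) y) > 0" by simp
  have herm: "ctranspose (B - C) = B - C"
    using B C by (simp add: psd_mat_def ctranspose_diff)
  obtain v l where v: "v \<noteq> 0" and l: "l > 0" and e: "(B - C) *v v = l *\<^sub>R v"
    by (rule hermitian_max_eigenvector[OF herm pos])
  have hB: "ctranspose B = B" and hC: "ctranspose C = C" using B C by (auto simp: psd_mat_def)
  have e': "B *v v = C *v v + l *\<^sub>R v"
    using e by (simp add: matrix_vector_mult_diff_rdistrib algebra_simps)
  have "B *v (B *v v) = C *v (C *v v)"
    using eq by (simp add: matrix_vector_mul_assoc)
  then have "cinner (B *v v) (B *v v) = cinner (C *v v) (C *v v)"
    by (metis hB hC hermitian_cinner)
  from arg_cong[OF this, of Re] have "l * (Re (cinner (B *v v) v) + Re (cinner (C *v v) v)) = 0"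
    unfolding e' by (simp add: cinner_add_left cinner_add_right scaleR_eq_scale cinner_scale_left
      cinner_scale_right hermitian_cinner[OF hC] algebra_simps)
  then have "Re (cinner (B *v v) v) + Re (cinner (C *v v) v) = 0" using l by simp
  moreover have "Re (cinner (B *v v) v) \<ge> 0" "Re (cinner (C *v v) v) \<ge> 0"
    using B C by (auto simp: psd_mat_def)
  ultimately have "Re (cinner (B *v v) v) = 0" "Re (cinner (C *v v) v) = 0" by linarith+
  then have "B *v v = 0" "C *v v = 0" using psd_mat_eq_0 B C by blast+
  with e' have "l *\<^sub>R v = 0" by simp
  with v l show False by simp
qed

text \<open>The previous bound, used in both orders, makes the form of the Hermitian matrix
  \<open>B - C\<close> vanish. This gives the uniqueness that the description in
  \<open>mat_abs\<close> requires.\<close>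

lemma psd_mat_sqrt_unique:
  fixes B C :: "complex^'n^'n"
  assumes B: "psd_mat B" and C: "psd_mat C" and eq: "B ** B = C ** C"
  shows "B = C"
proof -
  have "quad_fun (B - C) x = 0" for x
  proof -
    have "Re (quad_fun (C - B) x) = - Re (quad_fun (B - C) x)"
      by (simp add: quad_fun_def matrix_vector_mult_diff_rdistrib cinner_diff_left)
    then have "Re (quad_fun (B - C) x) = 0"
      using psd_mat_sqrt_diff_nonpos[OF B C eq, of x] psd_mat_sqrt_diff_nonpos[OF C B eq[symmetric], of x]
      by linarith
    moreover have "ctranspose (B - C) = B - C"
      using B C by (simp add: psd_mat_def ctranspose_diff)
    ultimately show ?thesis using hermitian_quad_real[of "B - C" x] by simp
  qed
  then have "B - C = 0" by (intro quad_fun_eq_0_imp)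
  then show ?thesis by simp
qed

section \<open>Rank-one matrices and unitaries that rotate one direction\<close>

definition vec_outer :: "complex^'n \<Rightarrow> complex^'n \<Rightarrow> complex^'n^'n" where
  "vec_outer u v = (\<chi> i j. u $ i * cnj (v $ j))"

abbreviation vec_proj :: "complex^'n \<Rightarrow> complex^'n^'n" where
  "vec_proj v \<equiv> vec_outer v v"

lemma vec_outer_mult: "vec_outer u v *v x = cinner x v *s u"
  by (simp add: vec_eq_iff vec_outer_def matrix_vector_mult_def cinner_def sum_distrib_left mult_ac)

lemma ctranspose_vec_outer: "ctranspose (vec_outer u v) = vec_outer v u"
  by (simp add: vec_eq_iff vec_outer_def ctranspose_def mult.commute)

text \<open>For a unit vector \<open>v\<close> this multiplies \<open>v\<close> by \<open>w\<close>
  and fixes the orthogonal complement of \<open>v\<close>. With \<open>w = cis t\<close> it is the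
  one-parameter unitary group generated by \<i> times the projection onto \<open>v\<close>.\<close>

definition phase_mat :: "complex \<Rightarrow> complex^'n \<Rightarrow> complex^'n^'n" where
  "phase_mat w v = mat 1 + mat (w - 1) ** vec_proj v"

lemma mat_mult_left: "(mat c :: complex^'n^'n) ** A = (\<chi> i j. c * A $ i $ j)"
  by (simp add: vec_eq_iff matrix_matrix_mult_def mat_def if_distrib if_distribR cong: if_cong)

lemma mat_mult_vec: "(mat c :: complex^'n^'n) *v x = c *s x"
  by (simp add: vec_eq_iff matrix_vector_mult_def mat_def if_distrib if_distribR cong: if_cong)

lemma phase_mat_mult: "phase_mat w v *v x = x + ((w - 1) * cinner x v) *s v"
  by (simp add: phase_mat_def matrix_vector_mult_add_rdistrib matrix_vector_mul_assoc[symmetric] vec_outer_mult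
    mat_mult_vec vec_eq_iff algebra_simps)

lemma ctranspose_phase_mat: "ctranspose (phase_mat w v) = phase_mat (cnj w) v"
  unfolding phase_mat_def mat_mult_left by (simp add: vec_outer_def vec_eq_iff ctranspose_def mat_def mult_ac)

lemma unitary_phase_mat:
  assumes "norm v = 1" and "norm w = 1"
  shows "unitary_mat (phase_mat w v)"
proof -
  have vv: "cinner v v = 1" using assms by (simp add: cinner_self)
  have "cmod w ^ 2 = 1" using assms by simp
  then have "w * cnj w = 1" by (metis complex_norm_square of_real_1)
  then have *: "phase_mat w v *v (phase_mat (cnj w) v *v x) = x" "phase_mat (cnj w) v *v (phase_mat w v *v x) = x" for x
    by (simp_all add: phase_mat_mult cinner_add_left cinner_scale_left vv vec_eq_iff algebra_simps)
  then show ?thesis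
    by (simp add: unitary_mat_def ctranspose_phase_mat matrix_eq matrix_vector_mul_assoc[symmetric])
qed

lemma trace_vec_proj_mult: "trace (vec_proj v ** M) = quad_fun M v"
  by (simp add: trace_def vec_outer_def matrix_matrix_mult_def quad_fun_def cinner_def matrix_vector_mult_def
    sum_distrib_left sum_distrib_right mult_ac) (rule sum.swap)

lemma matrix_add_rdistrib: "(A + B) ** C = A ** C + B ** (C :: complex^'n^'n)"
  by (simp add: vec_eq_iff matrix_matrix_mult_def algebra_simps sum.distrib)

lemma norm_le_sum_components: "norm (x :: 'a::real_normed_vector^'n) \<le> (\<Sum>i\<in>UNIV. norm (x $ i))"
  unfolding norm_vec_def by (rule L2_set_le_sum) simp

lemma trace_mat_mult: "trace (mat c ** A) = c * trace (A :: complex^'n^'n)"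
  by (simp add: trace_def mat_mult_left sum_distrib_left)

section \<open>Polar decomposition and the matrix absolute value\<close>

lemma compact_unitary: "compact {U :: complex^'n^'n. unitary_mat U}"
proof -
  have c: "continuous_on UNIV (\<lambda>U :: complex^'n^'n. ctranspose U ** U)"
    "continuous_on UNIV (\<lambda>U :: complex^'n^'n. U ** ctranspose U)"
    unfolding ctranspose_def matrix_matrix_mult_def by (auto intro!: continuous_intros)
  have "closed {U :: complex^'n^'n. unitary_mat U}"
    unfolding unitary_mat_def
    by (intro closed_Collect_conj closed_Collect_eq c continuous_on_const)
  moreover have "bounded {U :: complex^'n^'n. unitary_mat U}"
  proof (rule boundedI)
    fix U :: "complex^'n^'n" assume "U \<in> {U. unitary_mat U}"
    then have U: "unitary_mat U" by simp
    have "norm (U $ i) \<le> (\<Sum>j\<in>(UNIV::'n set). 1)" for i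
    proof (rule order_trans[OF norm_le_sum_components])
      \<comment> \<open>Each entry is a coordinate of the image of a unit axis vector, and
        \<open>U\<close> preserves norms.\<close>
      have "norm (U $ i $ j) \<le> 1" for j
      proof -
        have "norm ((U *v axis j 1) $ i) \<le> norm (U *v axis j 1)"
          by (rule Finite_Cartesian_Product.norm_nth_le)
        then show ?thesis
          by (simp add: norm_unitary_mult[OF U] matrix_vector_mult_axis_complex)
      qed
      then show "(\<Sum>j\<in>UNIV. norm (U $ i $ j)) \<le> (\<Sum>j\<in>(UNIV::'n set). 1)"
        by (intro sum_mono)
    qed
    then show "norm U \<le> (\<Sum>i\<in>(UNIV::'n set). \<Sum>j\<in>(UNIV::'n set). 1)"
      by (rule order_trans[OF norm_le_sum_components sum_mono])
  qed
  ultimately show ?thesis by (simp add: compact_eq_bounded_closed)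
qed

text \<open>Polar decomposition: at a maximizer \<open>U\<close> of \<open>Re (trace (U ** A))\<close> over the unitary group, perturbing
  \<open>U\<close> by unitaries that only rotate a single direction \<open>v\<close> shows that the quadratic form of
  \<open>U ** A\<close> at \<open>v\<close> is a nonnegative real.\<close>

lemma polar_decomposition:
  fixes A :: "complex^'n^'n"
  obtains U where "unitary_mat U" "psd_mat (U ** A)"
proof -
  let ?S = "{U :: complex^'n^'n. unitary_mat U}"
  have "mat 1 \<in> ?S" by (simp add: unitary_mat_def ctranspose_mat)
  then have ne: "?S \<noteq> {}" by blast
  have "continuous_on ?S (\<lambda>U. Re (trace (U ** A)))"
    unfolding trace_def matrix_matrix_mult_def by (auto intro!: continuous_intros)
  from continuous_attains_sup[OF compact_unitary ne this] obtain U
    where U: "unitary_mat U" and max: "\<And>V. unitary_mat V \<Longrightarrow> Re (trace (V ** A)) \<le> Re (trace (U ** A))"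
    by auto
  define M where "M = U ** A"
  have le: "Re (w * quad_fun M v) \<le> Re (quad_fun M v)" if "norm v = 1" "norm w = 1" for v w
  proof -
    have "unitary_mat (phase_mat w v ** U)"
      using unitary_phase_mat[OF that] U unfolding unitary_mat_def
      by (metis ctranspose_mult matrix_mul_assoc matrix_mul_lid)
    from max[OF this] have "Re (trace (phase_mat w v ** M)) \<le> Re (trace M)"
      by (simp add: M_def matrix_mul_assoc)
    moreover have "trace (phase_mat w v ** M) = trace M + (w - 1) * quad_fun M v"
      by (simp add: phase_mat_def matrix_add_rdistrib trace_add matrix_mul_assoc[symmetric] trace_mat_mult trace_vec_proj_mult)
    ultimately show ?thesis by (simp add: algebra_simps)
  qed
  have nn: "quad_fun M v = of_real (cmod (quad_fun M v))" if "norm v = 1" for v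
  proof (cases "quad_fun M v = 0")
    case False
    let ?q = "quad_fun M v"
    \<comment> \<open>The conjugate phase of \<open>?q\<close> rotates it onto the positive axis.
      Maximality then gives \<open>cmod ?q \<le> Re ?q\<close>, which is possible only if
      \<open>?q\<close> is real and nonnegative.\<close>
    let ?w = "cnj ?q / of_real (cmod ?q)"
    have "norm ?w = 1" using False by (simp add: norm_divide)
    moreover have "?w * ?q = of_real (cmod ?q)"
      using False complex_norm_square[of ?q] by (simp add: field_simps power2_eq_square)
    ultimately have "cmod ?q \<le> Re ?q" using le[OF that, of ?w] by simp
    then have "Re ?q = cmod ?q" using complex_Re_le_cmod[of ?q] by simp
    then show ?thesis
      using cmod_power2[of ?q] by (simp add: complex_eq_iff)
  qed simp
  have "ctranspose M = M"
    by (rule ctranspose_eq_selfI) (metis nn Reals_of_real dist_0_norm mem_sphere)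
  moreover have "0 \<le> Re (cinner (M *v x) x)" for x
  proof (cases "x = 0")
    case False
    then have "norm (inverse (norm x) *\<^sub>R x) = 1" by simp
    then have "0 \<le> Re (quad_fun M (inverse (norm x) *\<^sub>R x))" by (metis nn Re_complex_of_real norm_ge_zero)
    then show ?thesis using False
      by (simp add: quad_fun_def scaleR_eq_scale matrix_vector_mult_scale cinner_scale_left cinner_scale_right zero_le_divide_iff zero_le_mult_iff)
  qed simp
  ultimately have "psd_mat (U ** A)" by (simp add: psd_mat_def M_def)
  with U show thesis by (rule that)
qed

text \<open>If \<open>U ** A\<close> is positive semidefinite with \<open>U\<close> unitary, its
  Hermitian symmetry makes its square equal to \<open>ctranspose A ** A\<close>. So a positive
  square root exists, and together with uniqueness the definite description denotes it.\<close>

lemma mat_abs_square: "mat_abs A ** mat_abs A = ctranspose A ** (A :: complex^'n^'n)"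
proof -
  obtain U where U: "unitary_mat U" and B: "psd_mat (U ** A)" by (rule polar_decomposition)
  have "(U ** A) ** (U ** A) = ctranspose (U ** A) ** (U ** A)"
    using B by (simp add: psd_mat_def)
  also have "\<dots> = ctranspose A ** (ctranspose U ** U) ** A"
    by (simp add: ctranspose_mult matrix_mul_assoc)
  also have "\<dots> = ctranspose A ** A"
    using U by (simp add: unitary_mat_def)
  finally have sq: "(U ** A) ** (U ** A) = ctranspose A ** A" .
  have uniq: "C = U ** A" if "psd_mat C \<and> C ** C = ctranspose A ** A" for C
    by (rule psd_mat_sqrt_unique[OF _ B]) (simp_all add: that sq)
  have "psd_mat (mat_abs A) \<and> mat_abs A ** mat_abs A = ctranspose A ** A"
    unfolding mat_abs_def by (rule theI[where P = "\<lambda>B. psd_mat B \<and> B ** B = ctranspose A ** A",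
      OF conjI[OF B sq] uniq])
  then show ?thesis by (rule conjunct2)
qed

section \<open>Minkowski inequality\<close>

text \<open>The fourth power is the square of the square, so convexity of the square is used twice.
  For the square, the convexity defect is exactly l m (u - v)^2.\<close>

lemma power4_convex:
  fixes l m x y :: real
  assumes "0 \<le> l" "0 \<le> m" "l + m = 1"
  shows "(l * x + m * y) ^ 4 \<le> l * x ^ 4 + m * y ^ 4"
proof -
  have sq: "(l * u + m * v)\<^sup>2 \<le> l * u\<^sup>2 + m * v\<^sup>2" for u v
  proof -
    have m: "m = 1 - l" using assms by simp
    have "l * u\<^sup>2 + m * v\<^sup>2 - (l * u + m * v)\<^sup>2 = l * m * (u - v)\<^sup>2"
      unfolding m by (simp add: power2_eq_square algebra_simps)
    also have "\<dots> \<ge> 0" using assms by simp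
    finally show ?thesis by simp
  qed
  have "(l * x + m * y) ^ 4 = ((l * x + m * y)\<^sup>2)\<^sup>2" by simp
  also have "\<dots> \<le> (l * x\<^sup>2 + m * y\<^sup>2)\<^sup>2" by (rule power_mono[OF sq]) simp
  also have "\<dots> \<le> l * (x\<^sup>2)\<^sup>2 + m * (y\<^sup>2)\<^sup>2" by (rule sq)
  finally show ?thesis by simp
qed

lemma cmod_power4_convex:
  assumes "0 \<le> l" "0 \<le> m" "l + m = 1"
  shows "cmod (of_real l * z + of_real m * w) ^ 4 \<le> l * cmod z ^ 4 + m * cmod w ^ 4"
proof -
  have "cmod (of_real l * z + of_real m * w) \<le> l * cmod z + m * cmod w"
    using norm_triangle_ineq[of "of_real l * z" "of_real m * w"] assms by (simp add: norm_mult)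
  then have "cmod (of_real l * z + of_real m * w) ^ 4 \<le> (l * cmod z + m * cmod w) ^ 4"
    by (rule power_mono) simp
  also have "\<dots> \<le> l * cmod z ^ 4 + m * cmod w ^ 4" by (rule power4_convex[OF assms])
  finally show ?thesis .
qed

section \<open>Fourth moments and the norm axioms for \<open>Psi\<close>\<close>

lemma C_sphereD: "f \<in> C_sphere \<Longrightarrow> continuous_on (sphere 0 1) f"
  by (simp add: C_sphere_def)

lemma C_sphere_closed:
  assumes "f \<in> C_sphere"
  shows "(\<lambda>\<xi>. c * f \<xi>) \<in> C_sphere" "T_op f \<in> C_sphere"
    "g \<in> C_sphere \<Longrightarrow> (\<lambda>\<xi>. f \<xi> + g \<xi>) \<in> C_sphere"
  using assms by (auto simp: C_sphere_def T_op_def intro!: continuous_intros)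

lemma quad_fun_C_sphere: "quad_fun A \<in> C_sphere"
  by (simp add: C_sphere_def continuous_on_quad_fun)

lemma integrable_C_sphere: "f \<in> C_sphere \<Longrightarrow> integrable sigma_sphere f"
  by (simp add: C_sphere_def integrable_sigma_sphere)

lemma integrable_power4: "f \<in> C_sphere \<Longrightarrow> integrable sigma_sphere (\<lambda>\<xi>. cmod (f \<xi>) ^ 4)"
  by (intro integrable_sigma_sphere continuous_intros C_sphereD)

text \<open>The fourth power of the L4 norm. Without the root it is convex and homogeneous of degree
  four, and it can be computed by expanding the integrand.\<close>

definition moment4 :: "(complex^'n \<Rightarrow> complex) \<Rightarrow> real" where
  "moment4 f = (LINT \<xi>|sigma_sphere. cmod (f \<xi>) ^ 4)"

lemma moment4_nonneg: "0 \<le> moment4 f"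
  by (simp add: moment4_def)

lemma moment4_scale: "moment4 (\<lambda>\<xi>. c * f \<xi>) = cmod c ^ 4 * moment4 f"
  by (simp add: moment4_def norm_mult power_mult_distrib)

lemma moment4_convex:
  assumes "f \<in> C_sphere" "g \<in> C_sphere" "0 \<le> l" "0 \<le> m" "l + m = 1"
  shows "moment4 (\<lambda>\<xi>. of_real l * f \<xi> + of_real m * g \<xi>) \<le> l * moment4 f + m * moment4 g"
proof -
  have "moment4 (\<lambda>\<xi>. of_real l * f \<xi> + of_real m * g \<xi>)
      \<le> (LINT \<xi>|sigma_sphere. l * cmod (f \<xi>) ^ 4 + m * cmod (g \<xi>) ^ 4)"
    unfolding moment4_def
    by (rule integral_mono)
      (auto intro!: integrable_power4 integrable_C_sphere C_sphere_closed assms cmod_power4_convex)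
  also have "\<dots> = l * moment4 f + m * moment4 g"
    by (simp add: moment4_def integrable_power4 assms)
  finally show ?thesis .
qed

lemma moment4_eq_0:
  assumes "f \<in> C_sphere" "moment4 f = 0" "\<xi> \<in> sphere 0 1"
  shows "f \<xi> = 0"
proof -
  have "cmod (f \<xi>) ^ 4 = 0"
    by (rule integral_sigma_sphere_eq_0_imp)
      (use assms in \<open>auto simp: moment4_def intro!: continuous_intros C_sphereD\<close>)
  then show ?thesis by simp
qed

lemma integral_cong_sphere:
  "(\<And>\<xi>. \<xi> \<in> sphere (0::complex^'n) 1 \<Longrightarrow> f \<xi> = g \<xi>) \<Longrightarrow> (LINT \<xi>|sigma_sphere. f \<xi>) = (LINT \<xi>|sigma_sphere. g \<xi>)"
  by (rule Bochner_Integration.integral_cong) auto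

lemma moment4_unitary:
  assumes "f \<in> C_sphere" "unitary_mat U"
  shows "moment4 (\<lambda>\<xi>. f (U *v \<xi>)) = moment4 f"
  unfolding moment4_def
  by (rule integral_sigma_sphere_unitary[OF assms(2)]) (intro continuous_intros C_sphereD assms)

lemma d_coeff_pos: "d_coeff CARD('n::finite) > 0"
  unfolding d_coeff_def of_nat_0_less_iff by simp

text \<open>All radicands are nonnegative, so the fourth power undoes every root. The norm axioms
  below are derived from this root-free form.\<close>

lemma Psi_power4:
  fixes f :: "complex^'n \<Rightarrow> complex"
  shows "Psi f ^ 4 = 3 * d_coeff CARD('n) * moment4 f + real CARD('n) * d_coeff CARD('n) * moment4 (T_op f)"
  using d_coeff_pos[where 'n='n]
  by (simp add: Psi_def Psi1_def Psi2_def L4_norm_def moment4_def[symmetric] power_mult_distrib moment4_nonneg)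

lemma Psi_nonneg: "0 \<le> Psi f"
  by (simp add: Psi_def)

lemma Psi_cong:
  assumes "\<And>\<xi>. \<xi> \<in> sphere 0 1 \<Longrightarrow> f \<xi> = g \<xi>"
  shows "Psi f = Psi g"
proof -
  have "T_op f \<xi> = T_op g \<xi>" if "\<xi> \<in> sphere 0 1" for \<xi>
    using assms integral_cong_sphere[of f g] that by (simp add: T_op_def)
  then have "moment4 f = moment4 g" "moment4 (T_op f) = moment4 (T_op g)"
    unfolding moment4_def by (auto intro!: integral_cong_sphere simp: assms)
  then have "Psi f ^ 4 = Psi g ^ 4" by (simp add: Psi_power4)
  then show ?thesis using Psi_nonneg[of f] Psi_nonneg[of g] by (simp add: power_eq_iff_eq_base)
qed

lemma T_op_scale: "T_op (\<lambda>\<xi>. c * f \<xi>) = (\<lambda>\<xi>. c * T_op f \<xi>)"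
  by (simp add: T_op_def algebra_simps fun_eq_iff)

lemma T_op_add:
  assumes "f \<in> C_sphere" "g \<in> C_sphere"
  shows "T_op (\<lambda>\<xi>. f \<xi> + g \<xi>) = (\<lambda>\<xi>. T_op f \<xi> + T_op g \<xi>)"
  using assms by (simp add: T_op_def fun_eq_iff integrable_C_sphere)

lemma Psi_scale: "Psi (\<lambda>\<xi>. c * f \<xi>) = cmod c * Psi f"
proof -
  have "Psi (\<lambda>\<xi>. c * f \<xi>) ^ 4 = (cmod c * Psi f) ^ 4"
    by (simp add: Psi_power4 T_op_scale moment4_scale power_mult_distrib algebra_simps)
  then show ?thesis using Psi_nonneg[of f] Psi_nonneg[of "\<lambda>\<xi>. c * f \<xi>"]
    by (simp add: power_eq_iff_eq_base)
qed

lemma Psi_power4_convex: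
  fixes f g :: "complex^'n \<Rightarrow> complex"
  assumes f: "f \<in> C_sphere" and g: "g \<in> C_sphere" and lm: "0 \<le> l" "0 \<le> m" "l + m = 1"
  shows "Psi (\<lambda>\<xi>. of_real l * f \<xi> + of_real m * g \<xi>) ^ 4 \<le> l * Psi f ^ 4 + m * Psi g ^ 4"
proof -
  have T: "T_op (\<lambda>\<xi>. of_real l * f \<xi> + of_real m * g \<xi>) = (\<lambda>\<xi>. of_real l * T_op f \<xi> + of_real m * T_op g \<xi>)"
    using f g by (simp add: T_op_add T_op_scale C_sphere_closed)
  let ?a = "3 * d_coeff CARD('n)" and ?b = "real CARD('n) * d_coeff CARD('n)"
  have "Psi (\<lambda>\<xi>. of_real l * f \<xi> + of_real m * g \<xi>) ^ 4 \<le>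
      ?a * (l * moment4 f + m * moment4 g) + ?b * (l * moment4 (T_op f) + m * moment4 (T_op g))"
    unfolding Psi_power4 T using d_coeff_pos[where 'n='n]
    by (intro add_mono mult_left_mono moment4_convex f g lm C_sphere_closed) auto
  then show ?thesis by (simp add: Psi_power4 algebra_simps)
qed

text \<open>Rescale \<open>f\<close> and \<open>g\<close> to norm at most \<open>1\<close>; adding \<open>e / 2\<close> to the norms avoids division by zero.\<close>

lemma Psi_triangle:
  fixes f g :: "complex^'n \<Rightarrow> complex"
  assumes f: "f \<in> C_sphere" and g: "g \<in> C_sphere"
  shows "Psi (\<lambda>\<xi>. f \<xi> + g \<xi>) \<le> Psi f + Psi g"
proof (rule field_le_epsilon)
  fix e :: real assume e: "e > 0"
  define F G where "F = Psi f + e / 2" and "G = Psi g + e / 2"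
  have pos: "F > 0" "G > 0" using e Psi_nonneg[of f] Psi_nonneg[of g] by (auto simp: F_def G_def)
  define f' g' where "f' = (\<lambda>\<xi>. of_real (1 / F) * f \<xi>)" and "g' = (\<lambda>\<xi>. of_real (1 / G) * g \<xi>)"
  have "Psi f' \<le> 1" "Psi g' \<le> 1"
    unfolding f'_def g'_def Psi_scale norm_of_real using pos e by (auto simp: F_def G_def field_simps)
  then have le1: "Psi f' ^ 4 \<le> 1" "Psi g' ^ 4 \<le> 1"
    using Psi_nonneg by (auto intro!: power_le_one)
  have "f' \<in> C_sphere" "g' \<in> C_sphere"
    unfolding f'_def g'_def by (intro C_sphere_closed f g)+
  \<comment> \<open>With these weights the convex combination of \<open>f'\<close> and
    \<open>g'\<close> is f + g divided by F + G.\<close>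
  then have "Psi (\<lambda>\<xi>. of_real (F / (F + G)) * f' \<xi> + of_real (G / (F + G)) * g' \<xi>) ^ 4
      \<le> F / (F + G) * Psi f' ^ 4 + G / (F + G) * Psi g' ^ 4"
    using pos by (intro Psi_power4_convex) (auto simp: add_divide_distrib[symmetric])
  also have "\<dots> \<le> F / (F + G) * 1 + G / (F + G) * 1"
    using pos le1 by (intro add_mono mult_left_mono) auto
  also have "\<dots> = 1" using pos by (simp add: add_divide_distrib[symmetric])
  finally have "Psi (\<lambda>\<xi>. of_real (F / (F + G)) * f' \<xi> + of_real (G / (F + G)) * g' \<xi>) \<le> 1"
    by (subst (asm) power_le_one_iff[OF Psi_nonneg]) simp
  moreover have "(\<lambda>\<xi>. f \<xi> + g \<xi>) = (\<lambda>\<xi>. of_real (F + G) * (of_real (F / (F + G)) * f' \<xi> + of_real (G / (F + G)) * g' \<xi>))"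
  proof
    fix \<xi>
    have nz: "complex_of_real F \<noteq> 0" "complex_of_real G \<noteq> 0" "complex_of_real F + complex_of_real G \<noteq> 0"
      using pos by (auto simp flip: of_real_add)
    show "f \<xi> + g \<xi> = of_real (F + G) * (of_real (F / (F + G)) * f' \<xi> + of_real (G / (F + G)) * g' \<xi>)"
      using nz by (simp add: f'_def g'_def distrib_left)
  qed
  ultimately have "Psi (\<lambda>\<xi>. f \<xi> + g \<xi>) \<le> F + G"
    using pos by (simp add: Psi_scale mult_left_le del: of_real_add of_real_divide)
  then show "Psi (\<lambda>\<xi>. f \<xi> + g \<xi>) \<le> Psi f + Psi g + e" by (simp add: F_def G_def)
qed

lemma Psi_unitary:
  assumes f: "f \<in> C_sphere" and U: "unitary_mat U"
  shows "Psi (\<lambda>\<xi>. f (U *v \<xi>)) = Psi f"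
proof -
  have "T_op (\<lambda>\<xi>. f (U *v \<xi>)) = (\<lambda>\<xi>. T_op f (U *v \<xi>))"
    by (simp add: T_op_def integral_sigma_sphere_unitary[OF U C_sphereD[OF f]])
  then have "Psi (\<lambda>\<xi>. f (U *v \<xi>)) ^ 4 = Psi f ^ 4"
    using f U by (simp add: Psi_power4 moment4_unitary C_sphere_closed)
  then show ?thesis
    using Psi_nonneg[of f] Psi_nonneg[of "\<lambda>\<xi>. f (U *v \<xi>)"] by (simp add: power_eq_iff_eq_base)
qed

lemma Psi_eq_0_iff:
  fixes f :: "complex^'n \<Rightarrow> complex"
  assumes f: "f \<in> C_sphere"
  shows "Psi f = 0 \<longleftrightarrow> (\<forall>\<xi>\<in>sphere 0 1. f \<xi> = 0)"
proof
  assume "Psi f = 0"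
  then have "3 * d_coeff CARD('n) * moment4 f + real CARD('n) * d_coeff CARD('n) * moment4 (T_op f) = 0"
    using Psi_power4[of f] by simp
  moreover have "0 \<le> real CARD('n) * d_coeff CARD('n) * moment4 (T_op f)" "0 \<le> 3 * d_coeff CARD('n) * moment4 f"
    using d_coeff_pos[where 'n='n] moment4_nonneg by (auto intro!: mult_nonneg_nonneg)
  ultimately have "3 * d_coeff CARD('n) * moment4 f = 0" by linarith
  then have "moment4 f = 0" using d_coeff_pos[where 'n='n] by simp
  then show "\<forall>\<xi>\<in>sphere 0 1. f \<xi> = 0" using moment4_eq_0[OF f] by blast
next
  assume "\<forall>\<xi>\<in>sphere 0 1. f \<xi> = 0"
  then have "Psi f = Psi (\<lambda>\<xi>. 0 * f \<xi>)" by (intro Psi_cong) auto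
  also have "\<dots> = 0" by (subst Psi_scale) simp
  finally show "Psi f = 0" .
qed

lemma unitarily_invariant_norm_Psi: "unitarily_invariant_norm Psi"
  by (simp add: unitarily_invariant_norm_def Psi_nonneg Psi_eq_0_iff Psi_scale Psi_triangle Psi_unitary)

section \<open>The induced norm on matrices\<close>

lemma quad_fun_add: "quad_fun (A + B) = (\<lambda>\<xi>. quad_fun A \<xi> + quad_fun B \<xi>)"
  by (simp add: fun_eq_iff quad_fun_def matrix_vector_mult_add_rdistrib cinner_add_left)

lemma quad_fun_mat_mult: "quad_fun (mat c ** A) = (\<lambda>\<xi>. c * quad_fun A \<xi>)"
  by (simp add: fun_eq_iff quad_fun_def matrix_vector_mul_assoc[symmetric] mat_mult_vec cinner_scale_left)

lemma quad_fun_unitary: "quad_fun (U ** A ** ctranspose U) \<xi> = quad_fun A (ctranspose U *v \<xi>)"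
  by (simp add: quad_fun_def matrix_vector_mul_assoc[symmetric] cinner_adjoint[of U])

text \<open>Conjugating \<open>A\<close> by \<open>U\<close> composes its form with
  \<open>ctranspose U\<close>, so invariance carries over. Definiteness holds because a complex
  matrix is determined by its form on the sphere, and the other axioms follow from linearity of
  \<open>quad_fun\<close> in the matrix.\<close>

lemma weakly_unitarily_invariant_induced_norm:
  fixes \<Phi> :: "(complex^'n \<Rightarrow> complex) \<Rightarrow> real"
  assumes "unitarily_invariant_norm \<Phi>"
  shows "weakly_unitarily_invariant_norm (induced_norm \<Phi>)"
proof -
  have q: "quad_fun A \<in> C_sphere" for A :: "complex^'n^'n" by (rule quad_fun_C_sphere)
  have "\<Phi> (quad_fun A) = 0 \<longleftrightarrow> A = 0" for A
  proof -
    have "\<Phi> (quad_fun A) = 0 \<longleftrightarrow> (\<forall>\<xi>\<in>sphere 0 1. quad_fun A \<xi> = 0)"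
      using assms q by (simp add: unitarily_invariant_norm_def)
    also have "\<dots> \<longleftrightarrow> A = 0"
      by (auto simp: quad_fun_def intro!: quad_fun_eq_0_imp)
    finally show ?thesis .
  qed
  moreover have "\<Phi> (quad_fun (U ** A ** ctranspose U)) = \<Phi> (quad_fun A)" if "unitary_mat U" for A U
  proof -
    have "quad_fun (U ** A ** ctranspose U) = (\<lambda>\<xi>. quad_fun A (ctranspose U *v \<xi>))"
      by (simp add: fun_eq_iff quad_fun_unitary)
    then show ?thesis
      using assms q unitary_mat_ctranspose[OF that] unfolding unitarily_invariant_norm_def by simp
  qed
  ultimately show ?thesis
    using assms q unfolding weakly_unitarily_invariant_norm_def induced_norm_def unitarily_invariant_norm_def
    by (simp add: quad_fun_add quad_fun_mat_mult)
qed

section \<open>Moments of quadratic forms\<close>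

text \<open>A first-order Taylor expansion in t at 0, uniform on the sphere: \<open>q0\<close> is
  the value, \<open>q1\<close> the derivative, and the error is quadratic. The bounds on
  \<open>q0\<close> and \<open>q1\<close> are included so that the notion is closed under products;
  the uniform error bound can be integrated directly.\<close>

definition expands :: "(real \<Rightarrow> complex^'n \<Rightarrow> complex) \<Rightarrow> (complex^'n \<Rightarrow> complex) \<Rightarrow> (complex^'n \<Rightarrow> complex) \<Rightarrow> bool" where
  "expands q q0 q1 \<longleftrightarrow> (\<exists>K\<ge>0. \<forall>t\<in>{-1..1}. \<forall>\<xi>\<in>sphere 0 1.
     cmod (q t \<xi> - q0 \<xi> - of_real t * q1 \<xi>) \<le> K * t\<^sup>2 \<and> cmod (q0 \<xi>) \<le> K \<and> cmod (q1 \<xi>) \<le> K)"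

text \<open>The product rule. Writing dq and dr for the two remainders, the remainder of the product
  is dq r + (q0 + t q1) dr + t^2 q1 r1. The three pieces are bounded by 3, 2 and 1 times K L t^2,
  which explains the constant 6.\<close>

lemma expands_mult:
  assumes "expands q q0 q1" "expands r r0 r1"
  shows "expands (\<lambda>t \<xi>. q t \<xi> * r t \<xi>) (\<lambda>\<xi>. q0 \<xi> * r0 \<xi>) (\<lambda>\<xi>. q1 \<xi> * r0 \<xi> + q0 \<xi> * r1 \<xi>)"
proof -
  from assms(1)[unfolded expands_def] obtain K where K: "K \<ge> 0" and
    q': "\<forall>t\<in>{-1..1}. \<forall>\<xi>\<in>sphere 0 1. cmod (q t \<xi> - q0 \<xi> - of_real t * q1 \<xi>) \<le> K * t\<^sup>2 \<and> cmod (q0 \<xi>) \<le> K \<and> cmod (q1 \<xi>) \<le> K"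
    by blast
  note q = q'[rule_format]
  from assms(2)[unfolded expands_def] obtain L where L: "L \<ge> 0" and
    r': "\<forall>t\<in>{-1..1}. \<forall>\<xi>\<in>sphere 0 1. cmod (r t \<xi> - r0 \<xi> - of_real t * r1 \<xi>) \<le> L * t\<^sup>2 \<and> cmod (r0 \<xi>) \<le> L \<and> cmod (r1 \<xi>) \<le> L"
    by blast
  note r = r'[rule_format]
  have "cmod (q t \<xi> * r t \<xi> - q0 \<xi> * r0 \<xi> - of_real t * (q1 \<xi> * r0 \<xi> + q0 \<xi> * r1 \<xi>)) \<le> 6 * K * L * t\<^sup>2"
    if t: "t \<in> {-1..1}" and \<xi>: "\<xi> \<in> sphere 0 1" for t \<xi>
  proof -
    let ?t = "complex_of_real t"
    let ?dq = "q t \<xi> - q0 \<xi> - ?t * q1 \<xi>" and ?dr = "r t \<xi> - r0 \<xi> - ?t * r1 \<xi>"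
    have b: "cmod ?dq \<le> K * t\<^sup>2" "cmod (q0 \<xi>) \<le> K" "cmod (q1 \<xi>) \<le> K"
      "cmod ?dr \<le> L * t\<^sup>2" "cmod (r0 \<xi>) \<le> L" "cmod (r1 \<xi>) \<le> L"
      using q[OF t \<xi>] r[OF t \<xi>] by blast+
    have t1: "\<bar>t\<bar> \<le> 1" using t by auto
    have t2: "t\<^sup>2 \<le> 1" using t1 by (simp add: abs_square_le_1)
    have nq: "cmod (q0 \<xi> + ?t * q1 \<xi>) \<le> 2 * K"
    proof -
      have "\<bar>t\<bar> * cmod (q1 \<xi>) \<le> 1 * K" by (rule mult_mono[OF t1 b(3)]) simp_all
      then show ?thesis
        using norm_triangle_ineq[of "q0 \<xi>" "?t * q1 \<xi>"] q[OF t \<xi>] by (simp add: norm_mult)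
    qed
    have nr: "cmod (r t \<xi>) \<le> 3 * L"
    proof -
      have "\<bar>t\<bar> * cmod (r1 \<xi>) \<le> 1 * L" by (rule mult_mono[OF t1 b(6)]) simp_all
      moreover have "L * t\<^sup>2 \<le> L" using t2 L by (simp add: mult_left_le)
      moreover have "cmod (r t \<xi>) \<le> cmod ?dr + cmod (r0 \<xi>) + cmod (?t * r1 \<xi>)"
        using norm_triangle_ineq[of "?dr + r0 \<xi>" "?t * r1 \<xi>"] norm_triangle_ineq[of ?dr "r0 \<xi>"] by simp
      moreover have "cmod (?t * r1 \<xi>) = \<bar>t\<bar> * cmod (r1 \<xi>)" by (simp add: norm_mult)
      ultimately show ?thesis using b by linarith
    qed
    have p1: "cmod ?dq * cmod (r t \<xi>) \<le> (K * t\<^sup>2) * (3 * L)"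
      by (rule mult_mono[OF b(1) nr]) (simp_all add: K)
    have p2: "cmod (q0 \<xi> + ?t * q1 \<xi>) * cmod ?dr \<le> (2 * K) * (L * t\<^sup>2)"
      by (rule mult_mono[OF nq b(4)]) (simp_all add: K)
    have p3: "t\<^sup>2 * (cmod (q1 \<xi>) * cmod (r1 \<xi>)) \<le> t\<^sup>2 * (K * L)"
      by (intro mult_left_mono mult_mono b(3) b(6)) (simp_all add: K)
    have eq: "q t \<xi> * r t \<xi> - q0 \<xi> * r0 \<xi> - ?t * (q1 \<xi> * r0 \<xi> + q0 \<xi> * r1 \<xi>)
      = ?dq * r t \<xi> + (q0 \<xi> + ?t * q1 \<xi>) * ?dr + of_real (t\<^sup>2) * (q1 \<xi> * r1 \<xi>)"
      by (simp add: algebra_simps power2_eq_square)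
    have "cmod (q t \<xi> * r t \<xi> - q0 \<xi> * r0 \<xi> - ?t * (q1 \<xi> * r0 \<xi> + q0 \<xi> * r1 \<xi>))
      \<le> cmod ?dq * cmod (r t \<xi>) + cmod (q0 \<xi> + ?t * q1 \<xi>) * cmod ?dr + t\<^sup>2 * (cmod (q1 \<xi>) * cmod (r1 \<xi>))"
      unfolding eq
      by (rule order_trans[OF norm_triangle_le[OF add_mono[OF norm_triangle_ineq order_refl]]])
        (simp add: norm_mult norm_power)
    also have "\<dots> \<le> (K * t\<^sup>2) * (3 * L) + (2 * K) * (L * t\<^sup>2) + t\<^sup>2 * (K * L)"
      by (rule add_mono[OF add_mono[OF p1 p2] p3])
    finally show ?thesis by (simp add: algebra_simps)
  qed
  moreover have "cmod (q0 \<xi> * r0 \<xi>) \<le> 6 * K * L" "cmod (q1 \<xi> * r0 \<xi> + q0 \<xi> * r1 \<xi>) \<le> 6 * K * L" 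
    if \<xi>: "\<xi> \<in> sphere 0 1" for \<xi>
  proof -
    have b: "cmod (q0 \<xi>) \<le> K" "cmod (q1 \<xi>) \<le> K" "cmod (r0 \<xi>) \<le> L" "cmod (r1 \<xi>) \<le> L"
      using q[of 0 \<xi>] r[of 0 \<xi>] \<xi> by auto
    have "cmod (q0 \<xi> * r0 \<xi>) \<le> K * L" "cmod (q1 \<xi> * r0 \<xi>) \<le> K * L" "cmod (q0 \<xi> * r1 \<xi>) \<le> K * L"
      unfolding norm_mult using b K L by (auto intro!: mult_mono)
    moreover have "0 \<le> K * L" using K L by simp
    ultimately show "cmod (q0 \<xi> * r0 \<xi>) \<le> 6 * K * L" "cmod (q1 \<xi> * r0 \<xi> + q0 \<xi> * r1 \<xi>) \<le> 6 * K * L" 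
      using norm_triangle_ineq[of "q1 \<xi> * r0 \<xi>" "q0 \<xi> * r1 \<xi>"] by linarith+
  qed
  ultimately show ?thesis
    unfolding expands_def using K L by (intro exI[of _ "6 * K * L"]) auto
qed

text \<open>Integrating the expansion of a family with constant integral leaves |t| times the
  modulus of the integral of \<open>q1\<close>, bounded by K t^2. Dividing by |t| and letting t
  become small forces that integral to vanish.\<close>

lemma expands_integral_eq_0:
  assumes e: "expands q q0 q1"
    and q: "\<And>t. continuous_on (sphere 0 1) (q t)"
    and q0: "continuous_on (sphere 0 1) q0" and q1: "continuous_on (sphere 0 1) q1"
    and const: "\<And>t. (LINT \<xi>|sigma_sphere. q t \<xi>) = (LINT \<xi>|sigma_sphere. q0 \<xi>)"
  shows "(LINT \<xi>|sigma_sphere. q1 \<xi>) = 0"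
proof (rule ccontr)
  let ?I = "LINT \<xi>|sigma_sphere. q1 \<xi>"
  assume nz: "?I \<noteq> 0"
  obtain K where K: "K \<ge> 0" and
    b: "\<And>t \<xi>. t \<in> {-1..1} \<Longrightarrow> \<xi> \<in> sphere 0 1 \<Longrightarrow> cmod (q t \<xi> - q0 \<xi> - of_real t * q1 \<xi>) \<le> K * t\<^sup>2"
    using e unfolding expands_def by blast
  have le: "\<bar>t\<bar> * cmod ?I \<le> K * t\<^sup>2" if t: "t \<in> {-1..1}" for t
  proof -
    have "(LINT \<xi>|sigma_sphere. q t \<xi> - q0 \<xi> - of_real t * q1 \<xi>) = - of_real t * ?I"
      using q q0 q1 const by (simp add: integrable_sigma_sphere)
    then have "\<bar>t\<bar> * cmod ?I = cmod (LINT \<xi>|sigma_sphere. q t \<xi> - q0 \<xi> - of_real t * q1 \<xi>)"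
      by (simp add: norm_mult)
    also have "\<dots> \<le> (LINT \<xi>|sigma_sphere. cmod (q t \<xi> - q0 \<xi> - of_real t * q1 \<xi>))"
      by (rule integral_norm_bound)
    also have "\<dots> \<le> (LINT \<xi>|(sigma_sphere :: (complex^'a) measure). K * t\<^sup>2)"
      by (rule integral_mono) (auto intro!: integrable_sigma_sphere continuous_intros q q0 q1 b that)
    also have "\<dots> = K * t\<^sup>2"
      by (simp add: sigma_sphere.prob_space[unfolded space_sigma_sphere])
    finally show ?thesis .
  qed
  \<comment> \<open>The second argument of the minimum makes K t at most half the modulus of the
    integral, with \<open>K + 1\<close> guarding against K = 0; the first keeps t in the range where
    the expansion holds.\<close>
  define t where "t = min 1 (cmod ?I / ((K + 1) * 2))"
  have t: "0 < t" "t \<le> 1" using nz K by (auto simp: t_def)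
  have "K * t \<le> (K + 1) * (cmod ?I / ((K + 1) * 2))"
    using K t by (intro mult_mono) (auto simp: t_def)
  also have "\<dots> = cmod ?I / 2" using K by (simp del: distrib_right_numeral)
  also have "\<dots> < cmod ?I" using nz by simp
  finally have "t * (K * t) < t * cmod ?I" using t by (intro mult_strict_left_mono)
  then show False using le[of t] t by (simp add: power2_eq_square mult_ac)
qed

section \<open>Commutators and infinitesimal unitary invariance of the integral\<close>

abbreviation commutator :: "complex^'n^'n \<Rightarrow> complex^'n^'n \<Rightarrow> complex^'n^'n" where
  "commutator A X \<equiv> A ** X - X ** A"

lemma quad_fun_diff: "quad_fun (A - B) \<xi> = quad_fun A \<xi> - quad_fun B \<xi>"
  by (simp add: quad_fun_def matrix_vector_mult_diff_rdistrib cinner_diff_left)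

lemma quad_fun_bounded:
  fixes A :: "complex^'n^'n"
  shows "\<exists>K\<ge>0. \<forall>\<xi>\<in>sphere 0 1. cmod (quad_fun A \<xi>) \<le> K"
proof -
  have "compact (quad_fun A ` sphere 0 1)"
    by (rule compact_continuous_image[OF continuous_on_quad_fun]) simp
  then obtain B where "\<forall>x\<in>sphere 0 1. norm (quad_fun A x) \<le> B"
    using compact_imp_bounded bounded_iff by (metis imageI)
  then have "\<forall>x\<in>sphere 0 1. norm (quad_fun A x) \<le> max B 0" by (simp add: max.coboundedI1)
  then show ?thesis by (intro exI[of _ "max B 0"]) simp
qed

text \<open>With c = w - 1 the phase matrix is 1 + c X for the Hermitian matrix \<open>X\<close>.
  Expanding the form at (1 + c X) \<xi> gives an exact formula whose dependence on \<open>w\<close>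
  is only through c.\<close>

lemma quad_fun_phase_mat:
  fixes A :: "complex^'n^'n"
  fixes v :: "complex^'n"
  defines "X \<equiv> vec_proj v"
  shows "quad_fun A (phase_mat w v *v \<xi>) = quad_fun A \<xi> + (w - 1) * quad_fun (A ** X) \<xi>
    + cnj (w - 1) * quad_fun (X ** A) \<xi> + of_real ((cmod (w - 1))\<^sup>2) * quad_fun (X ** A ** X) \<xi>"
proof -
  define c where "c = w - 1"
  have e: "phase_mat w v *v \<xi> = \<xi> + c *s (X *v \<xi>)"
    by (simp add: phase_mat_mult X_def vec_outer_mult vec_eq_iff c_def)
  have X: "cinner x (X *v y) = cinner (X *v x) y" for x y
    by (simp add: X_def cinner_adjoint ctranspose_vec_outer)
  show ?thesis
    unfolding e quad_fun_def complex_norm_square c_def[symmetric]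
    by (simp add: matrix_vector_right_distrib matrix_vector_mult_scale cinner_add_left cinner_add_right
        cinner_scale_left cinner_scale_right X matrix_vector_mul_assoc[symmetric] algebra_simps)
qed

lemma cis_expansion: "cmod (cis t - 1 - \<i> * of_real t) \<le> t\<^sup>2" "cmod (cis t - 1) \<le> \<bar>t\<bar>"
proof -
  have "cmod (cis t - 1 - \<i> * of_real t) \<le> t\<^sup>2 / 2"
    using iexp_approx1[of t 1] by (simp add: cis_conv_exp algebra_simps power2_eq_square)
  moreover have "t\<^sup>2 / 2 \<le> t\<^sup>2" by simp
  ultimately show "cmod (cis t - 1 - \<i> * of_real t) \<le> t\<^sup>2" by (rule order_trans)
  show "cmod (cis t - 1) \<le> \<bar>t\<bar>"
    using iexp_approx1[of t 0] by (simp add: cis_conv_exp)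
qed

text \<open>Since \<open>cis t - 1\<close> is \<i> t up to a quadratic error, the terms AX and XA
  contribute \<i> and -\<i> times t, which together form the commutator. The term with X A X carries
  the squared modulus of \<open>cis t - 1\<close> and is of second order.\<close>

lemma expands_quad_fun:
  fixes A :: "complex^'n^'n"
  fixes v :: "complex^'n"
  defines "X \<equiv> vec_proj v"
  shows "expands (\<lambda>t \<xi>. quad_fun A (phase_mat (cis t) v *v \<xi>)) (quad_fun A) (\<lambda>\<xi>. \<i> * quad_fun (commutator A X) \<xi>)"
proof -
  obtain K0 where K0: "K0 \<ge> 0" "\<And>\<xi>. \<xi> \<in> sphere 0 1 \<Longrightarrow> cmod (quad_fun A \<xi>) \<le> K0"
    using quad_fun_bounded[of "A"] by blast
  obtain K1 where K1: "K1 \<ge> 0" "\<And>\<xi>. \<xi> \<in> sphere 0 1 \<Longrightarrow> cmod (quad_fun (A ** X) \<xi>) \<le> K1"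
    using quad_fun_bounded[of "A ** X"] by blast
  obtain K2 where K2: "K2 \<ge> 0" "\<And>\<xi>. \<xi> \<in> sphere 0 1 \<Longrightarrow> cmod (quad_fun (X ** A) \<xi>) \<le> K2"
    using quad_fun_bounded[of "X ** A"] by blast
  obtain K3 where K3: "K3 \<ge> 0" "\<And>\<xi>. \<xi> \<in> sphere 0 1 \<Longrightarrow> cmod (quad_fun (X ** A ** X) \<xi>) \<le> K3"
    using quad_fun_bounded[of "X ** A ** X"] by blast
  let ?K = "K0 + K1 + K2 + K3"
  have "cmod (quad_fun A (phase_mat (cis t) v *v \<xi>) - quad_fun A \<xi> - of_real t * (\<i> * quad_fun (commutator A X) \<xi>)) \<le> ?K * t\<^sup>2"
    if \<xi>: "\<xi> \<in> sphere 0 1" for t \<xi>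
  proof -
    let ?c = "cis t - 1 - \<i> * of_real t"
    have eq: "quad_fun A (phase_mat (cis t) v *v \<xi>) - quad_fun A \<xi> - of_real t * (\<i> * quad_fun (commutator A X) \<xi>)
      = ?c * quad_fun (A ** X) \<xi> + cnj ?c * quad_fun (X ** A) \<xi> + of_real ((cmod (cis t - 1))\<^sup>2) * quad_fun (X ** A ** X) \<xi>"
      unfolding quad_fun_phase_mat X_def quad_fun_diff by (simp add: algebra_simps)
    have "cmod (quad_fun A (phase_mat (cis t) v *v \<xi>) - quad_fun A \<xi> - of_real t * (\<i> * quad_fun (commutator A X) \<xi>))
      \<le> cmod ?c * cmod (quad_fun (A ** X) \<xi>) + cmod ?c * cmod (quad_fun (X ** A) \<xi>)
        + (cmod (cis t - 1))\<^sup>2 * cmod (quad_fun (X ** A ** X) \<xi>)"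
      unfolding eq
      by (rule order_trans[OF norm_triangle_le[OF add_mono[OF norm_triangle_ineq order_refl]]])
        (simp only: norm_mult complex_mod_cnj norm_of_real abs_power2 order_refl)
    also have "\<dots> \<le> t\<^sup>2 * K1 + t\<^sup>2 * K2 + \<bar>t\<bar>\<^sup>2 * K3"
      using K1 K2 K3 \<xi> cis_expansion[of t] by (intro add_mono mult_mono power_mono) auto
    also have "\<dots> \<le> ?K * t\<^sup>2" using K0 by (simp add: algebra_simps)
    finally show ?thesis .
  qed
  moreover have "cmod (\<i> * quad_fun (commutator A X) \<xi>) \<le> ?K" "cmod (quad_fun A \<xi>) \<le> ?K" if \<xi>: "\<xi> \<in> sphere 0 1" for \<xi>
    using norm_triangle_ineq4[of "quad_fun (A ** X) \<xi>" "quad_fun (X ** A) \<xi>"] K0(2)[OF \<xi>] K1(2)[OF \<xi>] K2(2)[OF \<xi>] K0(1) K1(1) K2(1) K3(1)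
    by (simp_all add: norm_mult quad_fun_diff)
  ultimately show ?thesis
    unfolding expands_def using K0(1) K1(1) K2(1) K3(1) by (intro exI[of _ ?K]) auto
qed

text \<open>The value at \<open>\<xi>\<close> of the quadratic form of \<open>commutator A (vec_outer u v)\<close>.\<close>

definition bracket :: "complex^'n^'n \<Rightarrow> complex^'n \<Rightarrow> complex^'n \<Rightarrow> complex^'n \<Rightarrow> complex" where
  "bracket A u v \<xi> = cinner \<xi> v * cinner (A *v u) \<xi> - cinner (A *v \<xi>) v * cinner u \<xi>"

text \<open>The bracket is linear in \<open>u\<close> and conjugate linear in \<open>v\<close>.
  Polarization therefore reaches every rank-one generator from the diagonal ones, which alone come
  from unitary groups.\<close>

lemma bracket_polarization:
  "4 * bracket A u v \<xi> = bracket A (u + v) (u + v) \<xi> - bracket A (u - v) (u - v) \<xi>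
    + \<i> * bracket A (u + \<i> *s v) (u + \<i> *s v) \<xi> - \<i> * bracket A (u - \<i> *s v) (u - \<i> *s v) \<xi>"
  by (simp add: bracket_def matrix_vector_right_distrib matrix_vector_mult_diff_distrib
      matrix_vector_mult_scale cinner_add_left cinner_add_right cinner_diff_left cinner_diff_right
      cinner_scale_left cinner_scale_right algebra_simps)

lemma bracket_scaleR: "bracket A (c *\<^sub>R u) (c *\<^sub>R u) \<xi> = of_real (c\<^sup>2) * bracket A u u \<xi>"
  by (simp add: bracket_def scaleR_eq_scale matrix_vector_mult_scale cinner_scale_left cinner_scale_right
      power2_eq_square algebra_simps)

lemma quad_fun_commutator_vec_proj: "quad_fun (commutator A (vec_proj v)) \<xi> = bracket A v v \<xi>"
  by (simp add: quad_fun_def bracket_def matrix_vector_mult_diff_rdistrib matrix_vector_mul_assoc[symmetric]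
      vec_outer_mult matrix_vector_mult_scale cinner_diff_left cinner_scale_left)

lemma continuous_on_bracket: "continuous_on S (bracket A u v)"
  unfolding bracket_def
  by (intro continuous_intros continuous_on_matrix_vector_mult continuous_on_id)

text \<open>The derivation given by the commutator with \<open>vec_outer u v\<close>, applied by the
  product rule to a product of four forms.\<close>

definition leibniz where
  "leibniz A B C D u v \<xi> =
     bracket A u v \<xi> * quad_fun B \<xi> * quad_fun C \<xi> * quad_fun D \<xi>
   + quad_fun A \<xi> * bracket B u v \<xi> * quad_fun C \<xi> * quad_fun D \<xi>
   + quad_fun A \<xi> * quad_fun B \<xi> * bracket C u v \<xi> * quad_fun D \<xi>
   + quad_fun A \<xi> * quad_fun B \<xi> * quad_fun C \<xi> * bracket D u v \<xi>"

lemma continuous_on_leibniz: "continuous_on S (leibniz A B C D u v)"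
  unfolding leibniz_def by (intro continuous_intros continuous_on_bracket continuous_on_quad_fun)

text \<open>The integral of the product of four forms is constant along the unitaries
  \<open>phase_mat (cis t) v\<close>, and its linear coefficient in t is \<i> times the Leibniz
  sum.\<close>

lemma integral_leibniz_unit:
  fixes A B C D :: "complex^'n^'n"
  assumes v: "norm v = 1"
  shows "(LINT \<xi>|sigma_sphere. leibniz A B C D v v \<xi>) = 0"
proof -
  let ?U = "\<lambda>t. phase_mat (cis t) v" and ?X = "vec_proj v"
  let ?p = "\<lambda>\<xi>. quad_fun A \<xi> * quad_fun B \<xi> * quad_fun C \<xi> * quad_fun D \<xi>"
  let ?d = "\<lambda>A \<xi>. \<i> * quad_fun (commutator A ?X) \<xi>"
  let ?q1 = "\<lambda>\<xi>. ((?d A \<xi> * quad_fun B \<xi> + quad_fun A \<xi> * ?d B \<xi>) * quad_fun C \<xi> + quad_fun A \<xi> * quad_fun B \<xi> * ?d C \<xi>) * quad_fun D \<xi>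
    + quad_fun A \<xi> * quad_fun B \<xi> * quad_fun C \<xi> * ?d D \<xi>"
  have cont: "continuous_on S ?p" for S by (intro continuous_intros continuous_on_quad_fun)
  have "(LINT \<xi>|sigma_sphere. ?q1 \<xi>) = 0"
  proof (rule expands_integral_eq_0)
    show "expands (\<lambda>t \<xi>. ?p (?U t *v \<xi>)) ?p ?q1"
      by (intro expands_mult expands_quad_fun)
    show "continuous_on (sphere 0 1) (\<lambda>\<xi>. ?p (?U t *v \<xi>))" for t
      by (intro continuous_on_compose2[OF cont[of UNIV]] continuous_on_matrix_vector_mult continuous_on_id) auto
    show "continuous_on (sphere 0 1) ?p" by (rule cont)
    show "continuous_on (sphere 0 1) ?q1" by (intro continuous_intros continuous_on_quad_fun)
    show "(LINT \<xi>|sigma_sphere. ?p (?U t *v \<xi>)) = (LINT \<xi>|sigma_sphere. ?p \<xi>)" for t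
      by (rule integral_sigma_sphere_unitary[OF unitary_phase_mat[OF v] cont]) simp
  qed
  moreover have "?q1 = (\<lambda>\<xi>. \<i> * leibniz A B C D v v \<xi>)"
    by (simp add: fun_eq_iff leibniz_def quad_fun_commutator_vec_proj algebra_simps)
  ultimately show ?thesis by simp
qed

lemma integral_leibniz_diag:
  fixes A B C D :: "complex^'n^'n"
  shows "(LINT \<xi>|sigma_sphere. leibniz A B C D v v \<xi>) = 0"
proof (cases "v = 0")
  case True
  then show ?thesis by (simp add: leibniz_def bracket_def)
next
  case False
  define w where "w = inverse (norm v) *\<^sub>R v"
  have w: "norm v *\<^sub>R w = v" "norm w = 1" using False by (simp_all add: w_def)
  have "bracket M v v \<xi> = of_real ((norm v)\<^sup>2) * bracket M w w \<xi>" for M :: "complex^'n^'n" and \<xi>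
    using bracket_scaleR[of M "norm v" w \<xi>] unfolding w(1) .
  then have "leibniz A B C D v v \<xi> = of_real ((norm v)\<^sup>2) * leibniz A B C D w w \<xi>" for \<xi>
    by (simp add: leibniz_def algebra_simps)
  moreover have "(LINT \<xi>|sigma_sphere. leibniz A B C D w w \<xi>) = 0"
    by (rule integral_leibniz_unit[OF w(2)])
  ultimately show ?thesis by simp
qed

text \<open>Every summand of the Leibniz sum contains exactly one bracket, so polarization passes
  through the whole sum. This is the complexification step: the generator need no longer be
  Hermitian.\<close>

lemma integral_leibniz:
  fixes A B C D :: "complex^'n^'n"
  shows "(LINT \<xi>|sigma_sphere. leibniz A B C D u v \<xi>) = 0"
proof -
  let ?L = "\<lambda>w \<xi>. leibniz A B C D w w \<xi>"
  have "4 * leibniz A B C D u v \<xi> = 4 * bracket A u v \<xi> * quad_fun B \<xi> * quad_fun C \<xi> * quad_fun D \<xi>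
   + quad_fun A \<xi> * (4 * bracket B u v \<xi>) * quad_fun C \<xi> * quad_fun D \<xi>
   + quad_fun A \<xi> * quad_fun B \<xi> * (4 * bracket C u v \<xi>) * quad_fun D \<xi>
   + quad_fun A \<xi> * quad_fun B \<xi> * quad_fun C \<xi> * (4 * bracket D u v \<xi>)" for \<xi>
    by (simp add: leibniz_def algebra_simps)
  also have "\<dots> \<xi> = ?L (u + v) \<xi> - ?L (u - v) \<xi> + \<i> * ?L (u + \<i> *s v) \<xi> - \<i> * ?L (u - \<i> *s v) \<xi>" for \<xi>
    unfolding bracket_polarization[of _ u v] leibniz_def by (simp add: algebra_simps)
  finally have "4 * (LINT \<xi>|sigma_sphere. leibniz A B C D u v \<xi>) =
    (LINT \<xi>|sigma_sphere. ?L (u + v) \<xi> - ?L (u - v) \<xi> + \<i> * ?L (u + \<i> *s v) \<xi> - \<i> * ?L (u - \<i> *s v) \<xi>)"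
    by (simp flip: integral_mult_right_zero)
  also have "\<dots> = 0"
    by (simp add: integrable_sigma_sphere continuous_on_leibniz integral_leibniz_diag)
  finally show ?thesis by simp
qed

section \<open>Summation over the matrix units\<close>

lemma sum_axis:
  fixes M :: "complex^'n^'n"
  shows "(\<Sum>a\<in>UNIV. x $ a * cinner (M *v axis a 1) y) = cinner (M *v x) y"
proof -
  have "(\<Sum>a\<in>UNIV. x $ a * cinner (M *v axis a 1) y) = (\<Sum>a\<in>UNIV. \<Sum>i\<in>UNIV. x $ a * (M $ i $ a * cnj (y $ i)))"
    by (simp add: cinner_def matrix_vector_mult_axis_complex sum_distrib_left)
  also have "\<dots> = (\<Sum>i\<in>UNIV. \<Sum>a\<in>UNIV. x $ a * (M $ i $ a * cnj (y $ i)))"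
    by (rule sum.swap)
  also have "\<dots> = cinner (M *v x) y"
    by (simp add: cinner_def matrix_vector_mult_def sum_distrib_left sum_distrib_right mult_ac)
  finally show ?thesis .
qed

lemma bracket_axis:
  "bracket M (axis b 1) (axis a 1) \<xi> = \<xi> $ a * cinner (M *v axis b 1) \<xi> - (M *v \<xi>) $ a * cnj (\<xi> $ b)"
  by (simp add: bracket_def cinner_axis_right cnj_cinner[symmetric, of \<xi>])
    (metis cinner_axis_right cnj_cinner)

lemma quad_fun_outer_axis: "quad_fun (vec_outer w (axis b 1)) \<xi> = \<xi> $ b * cinner w \<xi>"
  by (simp add: quad_fun_def vec_outer_mult cinner_scale_left cinner_axis_right)

lemma sum_cnj_self: "norm \<xi> = 1 \<Longrightarrow> (\<Sum>b\<in>UNIV. \<xi> $ b * cnj (\<xi> $ b)) = 1"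
  using cinner_self[of \<xi>] by (simp add: cinner_def)

text \<open>With matrix units E_ab, the outer products are Z E_ab and the generators are E_ba. The
  commutator is Z E_aa - Z_aa E_bb, and the double sum is n Z - tr(Z) I, whose form is evaluated at
  a unit vector.\<close>

lemma casimir_bracket:
  fixes Z :: "complex^'n^'n"
  assumes "norm \<xi> = 1"
  shows "(\<Sum>a\<in>UNIV. \<Sum>b\<in>UNIV. bracket (vec_outer (Z *v axis a 1) (axis b 1)) (axis b 1) (axis a 1) \<xi>)
    = of_nat CARD('n) * quad_fun Z \<xi> - trace Z"
proof -
  have "bracket (vec_outer (Z *v axis a 1) (axis b 1)) (axis b 1) (axis a 1) \<xi>
     = \<xi> $ a * cinner (Z *v axis a 1) \<xi> - Z $ a $ a * (\<xi> $ b * cnj (\<xi> $ b))" for a b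
    by (simp add: bracket_axis vec_outer_mult cinner_scale_left cinner_axis_right matrix_vector_mult_axis_complex)
  then have "(\<Sum>a\<in>UNIV. \<Sum>b\<in>UNIV. bracket (vec_outer (Z *v axis a 1) (axis b 1)) (axis b 1) (axis a 1) \<xi>)
    = of_nat CARD('n) * (\<Sum>a\<in>UNIV. \<xi> $ a * cinner (Z *v axis a 1) \<xi>)
     - (\<Sum>a\<in>UNIV. Z $ a $ a * (\<Sum>b\<in>UNIV. \<xi> $ b * cnj (\<xi> $ b)))"
    by (simp add: sum_subtractf sum_distrib_left)
  then show ?thesis
    by (simp add: sum_axis sum_cnj_self[OF assms] trace_def quad_fun_def)
qed

text \<open>The first term of the bracket lets the two factors exchange their indices, so the double
  sum factors into the product of the forms of \<open>Z\<close> and \<open>M\<close>. In the second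
  term the sum over b is the squared norm of \<xi>, which is 1, and the sum over a composes
  \<open>Z\<close> with \<open>M\<close>.\<close>

lemma casimir_product:
  fixes Z :: "complex^'n^'n"
  assumes "norm \<xi> = 1"
  shows "(\<Sum>a\<in>UNIV. \<Sum>b\<in>UNIV. quad_fun (vec_outer (Z *v axis a 1) (axis b 1)) \<xi> * bracket M (axis b 1) (axis a 1) \<xi>)
    = quad_fun Z \<xi> * quad_fun M \<xi> - quad_fun (Z ** M) \<xi>"
proof -
  have "quad_fun (vec_outer (Z *v axis a 1) (axis b 1)) \<xi> * bracket M (axis b 1) (axis a 1) \<xi>
     = (\<xi> $ a * cinner (Z *v axis a 1) \<xi>) * (\<xi> $ b * cinner (M *v axis b 1) \<xi>)
      - ((M *v \<xi>) $ a * cinner (Z *v axis a 1) \<xi>) * (\<xi> $ b * cnj (\<xi> $ b))" for a b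
    by (simp add: bracket_axis quad_fun_outer_axis algebra_simps)
  then have "(\<Sum>a\<in>UNIV. \<Sum>b\<in>UNIV. quad_fun (vec_outer (Z *v axis a 1) (axis b 1)) \<xi> * bracket M (axis b 1) (axis a 1) \<xi>)
    = (\<Sum>a\<in>UNIV. \<xi> $ a * cinner (Z *v axis a 1) \<xi>) * (\<Sum>b\<in>UNIV. \<xi> $ b * cinner (M *v axis b 1) \<xi>)
     - (\<Sum>a\<in>UNIV. (M *v \<xi>) $ a * cinner (Z *v axis a 1) \<xi>) * (\<Sum>b\<in>UNIV. \<xi> $ b * cnj (\<xi> $ b))"
    by (simp only: sum_subtractf sum_product)
  then show ?thesis
    by (simp add: sum_axis sum_cnj_self[OF assms] quad_fun_def matrix_vector_mul_assoc)
qed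

section \<open>The moment recursion and the explicit moments of order at most three\<close>

definition quad_moment :: "complex^'n^'n \<Rightarrow> complex^'n^'n \<Rightarrow> complex^'n^'n \<Rightarrow> complex^'n^'n \<Rightarrow> complex" where
  "quad_moment A B C D = (LINT \<xi>|sigma_sphere. quad_fun A \<xi> * quad_fun B \<xi> * quad_fun C \<xi> * quad_fun D \<xi>)"

lemma quad_fun_mat_1: "\<xi> \<in> sphere 0 1 \<Longrightarrow> quad_fun (mat 1) \<xi> = 1"
  by (simp add: quad_fun_def cinner_self)

text \<open>Sum the vanishing Leibniz integrals with first matrix Z E_ab and generator E_ba over all
  a and b. The bracket on the first factor contributes n and the trace term; each of the other three
  contributes 1 to the factor n + 3 and one composed matrix on the right.\<close>

lemma quad_moment_rec:
  fixes Z B C D :: "complex^'n^'n"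
  shows "(of_nat CARD('n) + 3) * quad_moment Z B C D = trace Z * quad_moment (mat 1) B C D
    + quad_moment (mat 1) (Z ** B) C D + quad_moment (mat 1) B (Z ** C) D + quad_moment (mat 1) B C (Z ** D)"
proof -
  let ?q = quad_fun
  define Y where "Y a b = vec_outer (Z *v axis a 1) (axis b 1)" for a b
  let ?L = "\<lambda>a b \<xi>. leibniz (Y a b) B C D (axis b 1) (axis a 1) \<xi>"
  have pointwise: "(\<Sum>a\<in>UNIV. \<Sum>b\<in>UNIV. ?L a b \<xi>)
    = (of_nat CARD('n) + 3) * (?q Z \<xi> * ?q B \<xi> * ?q C \<xi> * ?q D \<xi>)
      - trace Z * (?q (mat 1) \<xi> * ?q B \<xi> * ?q C \<xi> * ?q D \<xi>)
      - ?q (mat 1) \<xi> * ?q (Z ** B) \<xi> * ?q C \<xi> * ?q D \<xi>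
      - ?q (mat 1) \<xi> * ?q B \<xi> * ?q (Z ** C) \<xi> * ?q D \<xi>
      - ?q (mat 1) \<xi> * ?q B \<xi> * ?q C \<xi> * ?q (Z ** D) \<xi>" if \<xi>: "\<xi> \<in> sphere 0 1" for \<xi>
  proof -
    have n: "norm \<xi> = 1" using \<xi> by simp
    let ?P = "\<lambda>M. \<Sum>a\<in>UNIV. \<Sum>b\<in>UNIV. ?q (Y a b) \<xi> * bracket M (axis b 1) (axis a 1) \<xi>"
    have "?L a b \<xi> = bracket (Y a b) (axis b 1) (axis a 1) \<xi> * (?q B \<xi> * ?q C \<xi> * ?q D \<xi>)
      + ?q (Y a b) \<xi> * bracket B (axis b 1) (axis a 1) \<xi> * (?q C \<xi> * ?q D \<xi>)
      + ?q (Y a b) \<xi> * bracket C (axis b 1) (axis a 1) \<xi> * (?q B \<xi> * ?q D \<xi>)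
      + ?q (Y a b) \<xi> * bracket D (axis b 1) (axis a 1) \<xi> * (?q B \<xi> * ?q C \<xi>)" for a b
      by (simp add: leibniz_def algebra_simps)
    then have "(\<Sum>a\<in>UNIV. \<Sum>b\<in>UNIV. ?L a b \<xi>) =
        (\<Sum>a\<in>UNIV. \<Sum>b\<in>UNIV. bracket (Y a b) (axis b 1) (axis a 1) \<xi>) * (?q B \<xi> * ?q C \<xi> * ?q D \<xi>)
      + ?P B * (?q C \<xi> * ?q D \<xi>) + ?P C * (?q B \<xi> * ?q D \<xi>) + ?P D * (?q B \<xi> * ?q C \<xi>)"
      by (simp only: sum.distrib sum_distrib_right)
    also have "\<dots> = (of_nat CARD('n) * ?q Z \<xi> - trace Z) * (?q B \<xi> * ?q C \<xi> * ?q D \<xi>)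
      + (?q Z \<xi> * ?q B \<xi> - ?q (Z ** B) \<xi>) * (?q C \<xi> * ?q D \<xi>)
      + (?q Z \<xi> * ?q C \<xi> - ?q (Z ** C) \<xi>) * (?q B \<xi> * ?q D \<xi>)
      + (?q Z \<xi> * ?q D \<xi> - ?q (Z ** D) \<xi>) * (?q B \<xi> * ?q C \<xi>)"
      unfolding Y_def casimir_bracket[OF n] casimir_product[OF n] ..
    finally show ?thesis by (simp add: quad_fun_mat_1[OF \<xi>] algebra_simps)
  qed
  have int: "integrable sigma_sphere (\<lambda>\<xi>. ?q A1 \<xi> * ?q A2 \<xi> * ?q A3 \<xi> * ?q A4 \<xi>)" for A1 A2 A3 A4 :: "complex^'n^'n"
    by (intro integrable_sigma_sphere continuous_intros continuous_on_quad_fun)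
  have "0 = (\<Sum>a\<in>UNIV. \<Sum>b\<in>UNIV. LINT \<xi>|sigma_sphere. ?L a b \<xi>)"
    by (simp add: integral_leibniz)
  also have "\<dots> = (LINT \<xi>|sigma_sphere. (\<Sum>a\<in>UNIV. \<Sum>b\<in>UNIV. ?L a b \<xi>))"
    by (simp add: integrable_sigma_sphere continuous_on_leibniz)
  also have "\<dots> = (of_nat CARD('n) + 3) * quad_moment Z B C D - trace Z * quad_moment (mat 1) B C D
    - quad_moment (mat 1) (Z ** B) C D - quad_moment (mat 1) B (Z ** C) D - quad_moment (mat 1) B C (Z ** D)"
    by (subst integral_cong_sphere[OF pointwise]) (simp_all add: quad_moment_def int)
  finally show ?thesis by (simp add: algebra_simps)
qed

lemma integrable_quad_product:
  fixes A B C D :: "complex^'n^'n"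
  shows "integrable sigma_sphere (\<lambda>\<xi>. quad_fun A \<xi> * quad_fun B \<xi> * quad_fun C \<xi> * quad_fun D \<xi>)"
  by (intro integrable_sigma_sphere continuous_intros continuous_on_quad_fun)

lemma quad_moment_commute:
  "quad_moment B A C D = quad_moment A B C D"
  "quad_moment A C B D = quad_moment A B C D"
  "quad_moment A B D C = quad_moment A B C D"
  unfolding quad_moment_def by (simp_all add: mult_ac)

lemma of_nat_CARD_nonzero: "(of_nat CARD('n::finite) :: complex) \<noteq> 0" "(of_nat CARD('n) :: complex) + of_nat k \<noteq> 0"
  by (simp, simp flip: of_nat_add)

lemma quad_moment_mat_1: "quad_moment (mat 1) (mat 1) (mat 1) (mat 1 :: complex^'n^'n) = 1"
proof -
  have "quad_moment (mat 1) (mat 1) (mat 1) (mat 1 :: complex^'n^'n) = (LINT \<xi>|(sigma_sphere :: (complex^'n) measure). 1)"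
    unfolding quad_moment_def by (intro integral_cong_sphere) (simp add: quad_fun_mat_1)
  then show ?thesis
    by (simp add: sigma_sphere.prob_space[unfolded space_sigma_sphere])
qed

text \<open>An identity matrix among the last three arguments of the recursion reproduces the
  unknown moment on the right and lowers the factor n + 3 by one. Three identities leave n here; in
  the next two lemmas two and one identities leave n + 1 and n + 2.\<close>

lemma quad_moment_1:
  fixes D :: "complex^'n^'n"
  shows "of_nat CARD('n) * quad_moment (mat 1) (mat 1) (mat 1) D = trace D"
proof -
  have "quad_moment D (mat 1) (mat 1) (mat 1) = quad_moment (mat 1) (mat 1) (mat 1) D"
    "quad_moment (mat 1) D (mat 1) (mat 1) = quad_moment (mat 1) (mat 1) (mat 1) D"
    "quad_moment (mat 1) (mat 1) D (mat 1) = quad_moment (mat 1) (mat 1) (mat 1) D"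
    by (metis quad_moment_commute)+
  then show ?thesis
    using quad_moment_rec[of D "mat 1" "mat 1" "mat 1"] by (simp add: quad_moment_mat_1 algebra_simps)
qed

lemma quad_moment_2:
  fixes C D :: "complex^'n^'n"
  shows "(of_nat CARD('n) + 1) * quad_moment (mat 1) (mat 1) C D =
    trace C * quad_moment (mat 1) (mat 1) (mat 1) D + quad_moment (mat 1) (mat 1) (mat 1) (C ** D)"
proof -
  have "quad_moment C (mat 1) (mat 1) D = quad_moment (mat 1) (mat 1) C D"
    "quad_moment (mat 1) C (mat 1) D = quad_moment (mat 1) (mat 1) C D"
    by (metis quad_moment_commute)+
  then show ?thesis
    using quad_moment_rec[of C "mat 1" "mat 1" D] by (simp add: algebra_simps)
qed

lemma quad_moment_3:
  fixes B C D :: "complex^'n^'n"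
  shows "(of_nat CARD('n) + 2) * quad_moment (mat 1) B C D = trace B * quad_moment (mat 1) (mat 1) C D
    + quad_moment (mat 1) (mat 1) (B ** C) D + quad_moment (mat 1) (mat 1) C (B ** D)"
proof -
  have "quad_moment B (mat 1) C D = quad_moment (mat 1) B C D"
    "quad_moment (mat 1) (B ** C) (mat 1) D = quad_moment (mat 1) (mat 1) (B ** C) D"
    by (metis quad_moment_commute)+
  then show ?thesis
    using quad_moment_rec[of B "mat 1" C D] by (simp add: algebra_simps quad_moment_commute(2)[of "mat 1" "mat 1" C])
qed

text \<open>The right-hand sides are sums over all permutations of the nontrivial arguments, each
  contributing the product of the traces along its cycles. Denominators are kept on the left so that
  later steps remain polynomial as long as possible.\<close>

lemma quad_moments_explicit:
  fixes A B C D :: "complex^'n^'n"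
  defines "n \<equiv> of_nat CARD('n) :: complex"
  shows "n * quad_moment (mat 1) (mat 1) (mat 1) D = trace D"
    and "n * (n + 1) * quad_moment (mat 1) (mat 1) C D = trace C * trace D + trace (C ** D)"
    and "n * (n + 1) * (n + 2) * quad_moment (mat 1) B C D =
      trace B * (trace C * trace D + trace (C ** D)) + trace (B ** C) * trace D + trace (B ** C ** D)
      + trace C * trace (B ** D) + trace (C ** B ** D)"
proof -
  show *: "n * quad_moment (mat 1) (mat 1) (mat 1) D = trace D" for D :: "complex^'n^'n"
    unfolding n_def by (rule quad_moment_1)
  show **: "n * (n + 1) * quad_moment (mat 1) (mat 1) C D = trace C * trace D + trace (C ** D)" for C D :: "complex^'n^'n"
  proof -
    have "n * (n + 1) * quad_moment (mat 1) (mat 1) C D = n * ((n + 1) * quad_moment (mat 1) (mat 1) C D)"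
      by (simp only: mult.assoc)
    also have "\<dots> = trace C * (n * quad_moment (mat 1) (mat 1) (mat 1) D)
        + n * quad_moment (mat 1) (mat 1) (mat 1) (C ** D)"
      unfolding n_def quad_moment_2 by (simp only: distrib_left mult_ac)
    finally show ?thesis by (simp only: *)
  qed
  have "n * (n + 1) * (n + 2) * quad_moment (mat 1) B C D = n * (n + 1) * ((n + 2) * quad_moment (mat 1) B C D)"
    by (simp only: mult.assoc)
  also have "\<dots> = trace B * (n * (n + 1) * quad_moment (mat 1) (mat 1) C D)
     + n * (n + 1) * quad_moment (mat 1) (mat 1) (B ** C) D + n * (n + 1) * quad_moment (mat 1) (mat 1) C (B ** D)"
    unfolding n_def quad_moment_3 by (simp only: distrib_left mult_ac)
  finally show "n * (n + 1) * (n + 2) * quad_moment (mat 1) B C D =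
      trace B * (trace C * trace D + trace (C ** D)) + trace (B ** C) * trace D + trace (B ** C ** D)
      + trace C * trace (B ** D) + trace (C ** B ** D)"
    unfolding ** by (simp add: algebra_simps matrix_mul_assoc)
qed

section \<open>The fourth moment and the final formula\<close>

lemma quad_fun_ctranspose: "quad_fun (ctranspose A) \<xi> = cnj (quad_fun A \<xi>)"
  by (simp add: quad_fun_def cnj_cinner cinner_adjoint)

lemma integral_quad_fun: "(LINT \<xi>|sigma_sphere. quad_fun A \<xi>) = trace A / of_nat CARD('n)"
  for A :: "complex^'n^'n"
proof -
  have "quad_moment (mat 1) (mat 1) (mat 1) A = (LINT \<xi>|sigma_sphere. quad_fun A \<xi>)"
    unfolding quad_moment_def by (intro integral_cong_sphere) (simp add: quad_fun_mat_1)
  then show ?thesis using quad_moment_1[of A] by (simp add: field_simps)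
qed

text \<open>The form of \<open>B\<close> is the conjugate of the form of \<open>A\<close>, so the
  integrand is the square of (f - t)(cnj f - cnj t). Each monomial is padded with forms of
  \<open>mat 1\<close>, which are 1 on the sphere, to become a four-fold moment.\<close>

lemma moment4_quad_fun_diff:
  fixes A :: "complex^'n^'n"
  defines "B \<equiv> ctranspose A"
  shows "of_real (moment4 (\<lambda>\<xi>. quad_fun A \<xi> - t)) =
    quad_moment A A B B - 2 * cnj t * quad_moment (mat 1) A A B + (cnj t)\<^sup>2 * quad_moment (mat 1) (mat 1) A A
    - 2 * t * quad_moment (mat 1) A B B + 4 * t * cnj t * quad_moment (mat 1) (mat 1) A B
    - 2 * t * (cnj t)\<^sup>2 * quad_moment (mat 1) (mat 1) (mat 1) A
    + t\<^sup>2 * quad_moment (mat 1) (mat 1) B B - 2 * t\<^sup>2 * cnj t * quad_moment (mat 1) (mat 1) (mat 1) B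
    + t\<^sup>2 * (cnj t)\<^sup>2"
proof -
  let ?q = quad_fun and ?s = "cnj t" and ?I = "mat 1 :: complex^'n^'n"
  have *: "of_real (cmod (?q A \<xi> - t) ^ 4) =
    ?q A \<xi> * ?q A \<xi> * ?q B \<xi> * ?q B \<xi> - 2 * ?s * (?q ?I \<xi> * ?q A \<xi> * ?q A \<xi> * ?q B \<xi>)
    + ?s\<^sup>2 * (?q ?I \<xi> * ?q ?I \<xi> * ?q A \<xi> * ?q A \<xi>)
    - 2 * t * (?q ?I \<xi> * ?q A \<xi> * ?q B \<xi> * ?q B \<xi>) + 4 * t * ?s * (?q ?I \<xi> * ?q ?I \<xi> * ?q A \<xi> * ?q B \<xi>)
    - 2 * t * ?s\<^sup>2 * (?q ?I \<xi> * ?q ?I \<xi> * ?q ?I \<xi> * ?q A \<xi>)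
    + t\<^sup>2 * (?q ?I \<xi> * ?q ?I \<xi> * ?q B \<xi> * ?q B \<xi>) - 2 * t\<^sup>2 * ?s * (?q ?I \<xi> * ?q ?I \<xi> * ?q ?I \<xi> * ?q B \<xi>)
    + t\<^sup>2 * ?s\<^sup>2 * (?q ?I \<xi> * ?q ?I \<xi> * ?q ?I \<xi> * ?q ?I \<xi>)" if \<xi>: "\<xi> \<in> sphere 0 1" for \<xi>
  proof -
    have "of_real (cmod (?q A \<xi> - t) ^ 4) = (complex_of_real ((cmod (?q A \<xi> - t))\<^sup>2))\<^sup>2"
      by (simp flip: of_real_power)
    also have "\<dots> = ((?q A \<xi> - t) * (?q B \<xi> - ?s))\<^sup>2"
      unfolding complex_norm_square by (simp add: B_def quad_fun_ctranspose)
    finally show ?thesis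
      by (simp add: quad_fun_mat_1[OF \<xi>] power2_eq_square algebra_simps)
  qed
  have "of_real (moment4 (\<lambda>\<xi>. ?q A \<xi> - t)) = (LINT \<xi>|sigma_sphere. complex_of_real (cmod (?q A \<xi> - t) ^ 4))"
    unfolding moment4_def by (simp only: integral_complex_of_real)
  also have "\<dots> = quad_moment A A B B - 2 * ?s * quad_moment ?I A A B + ?s\<^sup>2 * quad_moment ?I ?I A A
    - 2 * t * quad_moment ?I A B B + 4 * t * ?s * quad_moment ?I ?I A B
    - 2 * t * ?s\<^sup>2 * quad_moment ?I ?I ?I A
    + t\<^sup>2 * quad_moment ?I ?I B B - 2 * t\<^sup>2 * ?s * quad_moment ?I ?I ?I B
    + t\<^sup>2 * ?s\<^sup>2 * quad_moment ?I ?I ?I ?I"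
    by (subst integral_cong_sphere[OF *]) (simp_all add: quad_moment_def integrable_quad_product)
  finally show ?thesis by (simp add: quad_moment_mat_1)
qed

lemma frobenius_norm_sq: "complex_of_real ((frobenius_norm A)\<^sup>2) = trace (A ** ctranspose A)"
  by (simp add: frobenius_norm_def sum_nonneg trace_def matrix_matrix_mult_def ctranspose_def
    complex_norm_square del: of_real_power)

text \<open>The fourth power of \<open>mat_abs A\<close> is the square of the Hermitian matrix
  \<open>?H\<close>, so its trace is the squared Frobenius norm of \<open>?H\<close>. It is thus
  real and nonnegative, which lets the root cancel; cyclicity of the trace then reorders the
  word.\<close>

lemma schatten4_norm_power4:
  fixes A :: "complex^'n^'n"
  shows "complex_of_real (schatten4_norm A ^ 4) = trace (A ** ctranspose A ** A ** ctranspose A)"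
proof -
  let ?H = "ctranspose A ** A"
  have "mat_abs A ** mat_abs A ** mat_abs A ** mat_abs A = ?H ** ?H"
    by (metis mat_abs_square matrix_mul_assoc)
  moreover have "ctranspose ?H = ?H" by (simp add: ctranspose_mult)
  ultimately have "trace (mat_abs A ** mat_abs A ** mat_abs A ** mat_abs A) = of_real ((frobenius_norm ?H)\<^sup>2)"
    by (simp only: frobenius_norm_sq)
  then have "schatten4_norm A ^ 4 = (frobenius_norm ?H)\<^sup>2"
    unfolding schatten4_norm_def by (simp only: Re_complex_of_real) simp
  then have "complex_of_real (schatten4_norm A ^ 4) = trace (?H ** ?H)"
    using frobenius_norm_sq[of ?H] \<open>ctranspose ?H = ?H\<close> by simp
  also have "\<dots> = trace (A ** ctranspose A ** A ** ctranspose A)"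
    by (subst trace_mul_sym) (simp add: matrix_mul_assoc, metis matrix_mul_assoc trace_mul_sym)
  finally show ?thesis .
qed

text \<open>One more step of the recursion on top of the third moments. The coefficients add up to
  24: again one product of traces over cycles for each permutation of the arguments A, A, B, B, with
  equal cyclic words collected.\<close>

lemma quad_moment_4:
  fixes A :: "complex^'n^'n"
  defines "n \<equiv> of_nat CARD('n) :: complex" and "B \<equiv> ctranspose A"
  shows "n * (n + 1) * (n + 2) * (n + 3) * quad_moment A A B B =
      (trace A)\<^sup>2 * (trace B)\<^sup>2 + (trace A)\<^sup>2 * trace (B ** B) + (trace B)\<^sup>2 * trace (A ** A)
      + 4 * trace A * trace B * trace (A ** B) + trace (A ** A) * trace (B ** B) + 2 * (trace (A ** B))\<^sup>2
      + 4 * trace A * trace (A ** B ** B) + 4 * trace B * trace (A ** A ** B)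
      + 4 * trace (A ** A ** B ** B) + 2 * trace (A ** B ** A ** B)"
proof -
  have cyc: "trace (B ** A) = trace (A ** B)" "trace (A ** B ** A) = trace (A ** A ** B)"
    "trace (B ** A ** A) = trace (A ** A ** B)" "trace (B ** A ** B) = trace (A ** B ** B)"
    "trace (B ** B ** A) = trace (A ** B ** B)" "trace (A ** B ** B ** A) = trace (A ** A ** B ** B)"
    "trace (B ** B ** A ** A) = trace (A ** A ** B ** B)" "trace (B ** A ** A ** B) = trace (A ** A ** B ** B)"
    "trace (B ** A ** B ** A) = trace (A ** B ** A ** B)"
    by (metis trace_mul_sym matrix_mul_assoc)+
  have "n * (n + 1) * (n + 2) * (n + 3) * quad_moment A A B B
    = n * (n + 1) * (n + 2) * ((n + 3) * quad_moment A A B B)"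
    by (simp only: mult.assoc)
  also have "\<dots> = trace A * (n * (n + 1) * (n + 2) * quad_moment (mat 1) A B B)
     + n * (n + 1) * (n + 2) * quad_moment (mat 1) (A ** A) B B
     + n * (n + 1) * (n + 2) * quad_moment (mat 1) A (A ** B) B
     + n * (n + 1) * (n + 2) * quad_moment (mat 1) A B (A ** B)"
    unfolding n_def quad_moment_rec by (simp add: algebra_simps)
  finally show ?thesis
    unfolding n_def quad_moments_explicit
    by (simp add: matrix_mul_assoc cyc power2_eq_square algebra_simps)
qed

text \<open>The weights 3 d and n d combine the pure fourth moments into (n + 3) d times one moment,
  which clears its denominator exactly. Centring at tr A / n then cancels the terms in which a trace
  multiplies the trace of a word of length three.\<close>

lemma Psi_quad_fun:
  fixes A :: "complex^'n^'n"
  defines "n \<equiv> of_nat CARD('n) :: complex" and "B \<equiv> ctranspose A"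
  shows "of_real (Psi (quad_fun A) ^ 4) = 4 * trace (A ** A ** B ** B) + 2 * trace (A ** B ** A ** B)
    + 2 * (trace (A ** B))\<^sup>2 + 2 / n * (trace (A ** A) * (trace B)\<^sup>2 + trace (B ** B) * (trace A)\<^sup>2)
    + 8 / n * trace (A ** B) * trace A * trace B + trace (A ** A) * trace (B ** B)
    + (3 * n - 6) / n\<^sup>2 * (trace A)\<^sup>2 * (trace B)\<^sup>2"
proof -
  have cyc: "trace (B ** A) = trace (A ** B)" "trace (A ** B ** A) = trace (A ** A ** B)"
    "trace (B ** A ** B) = trace (A ** B ** B)"
    by (metis trace_mul_sym matrix_mul_assoc)+
  have nz: "n \<noteq> 0" "n + 1 \<noteq> 0" "n + 2 \<noteq> 0" 
    using of_nat_CARD_nonzero(2)[of 1, where 'n='n] of_nat_CARD_nonzero(2)[of 2, where 'n='n] by (simp_all add: n_def)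
  define d where "d = n * (n + 1) * (n + 2)"
  have cB: "cnj (trace A / n) = trace B / n"
    by (simp add: B_def n_def trace_ctranspose)
  have T: "T_op (quad_fun A) = (\<lambda>\<xi>. quad_fun A \<xi> - trace A / n)"
    by (simp add: T_op_def integral_quad_fun n_def)
  have "complex_of_real (d_coeff CARD('n)) = d"
    by (simp add: d_coeff_def d_def n_def algebra_simps)
  \<comment> \<open>The first moment is written with a subtracted 0 so that the same expansion
    serves for both t = 0 and t = tr A / n.\<close>
  then have "of_real (Psi (quad_fun A) ^ 4) = 3 * d * of_real (moment4 (\<lambda>\<xi>. quad_fun A \<xi> - 0))
      + n * d * of_real (moment4 (\<lambda>\<xi>. quad_fun A \<xi> - trace A / n))"
    unfolding Psi_power4 T by (simp add: n_def)
  also have "\<dots> = (n + 3) * d * quad_moment A A B B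
    + n * d * (- 2 * (trace B / n) * quad_moment (mat 1) A A B + (trace B / n)\<^sup>2 * quad_moment (mat 1) (mat 1) A A
    - 2 * (trace A / n) * quad_moment (mat 1) A B B + 4 * (trace A / n) * (trace B / n) * quad_moment (mat 1) (mat 1) A B
    - 2 * (trace A / n) * (trace B / n)\<^sup>2 * quad_moment (mat 1) (mat 1) (mat 1) A
    + (trace A / n)\<^sup>2 * quad_moment (mat 1) (mat 1) B B - 2 * (trace A / n)\<^sup>2 * (trace B / n) * quad_moment (mat 1) (mat 1) (mat 1) B
    + (trace A / n)\<^sup>2 * (trace B / n)\<^sup>2)"
    unfolding moment4_quad_fun_diff cB B_def[symmetric] by (simp add: algebra_simps)
  \<comment> \<open>Regrouped so that each moment appears together with the factor that clears its
    denominator, ready for the explicit formulas.\<close>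
  also have "\<dots> = (n * (n + 1) * (n + 2) * (n + 3) * quad_moment A A B B)
    - 2 * trace B * (n * (n + 1) * (n + 2) * quad_moment (mat 1) A A B)
    - 2 * trace A * (n * (n + 1) * (n + 2) * quad_moment (mat 1) A B B)
    + (n + 2) / n * ((trace B)\<^sup>2 * (n * (n + 1) * quad_moment (mat 1) (mat 1) A A)
      + 4 * trace A * trace B * (n * (n + 1) * quad_moment (mat 1) (mat 1) A B)
      + (trace A)\<^sup>2 * (n * (n + 1) * quad_moment (mat 1) (mat 1) B B))
    - 2 * (n + 1) * (n + 2) / n\<^sup>2 * (trace A * (trace B)\<^sup>2 * (n * quad_moment (mat 1) (mat 1) (mat 1) A)
      + (trace A)\<^sup>2 * trace B * (n * quad_moment (mat 1) (mat 1) (mat 1) B))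
    + (n + 1) * (n + 2) / n\<^sup>2 * (trace A)\<^sup>2 * (trace B)\<^sup>2"
    unfolding d_def using nz(1) by (simp add: divide_simps power2_eq_square) (simp add: algebra_simps)
  also have "\<dots> = 4 * trace (A ** A ** B ** B) + 2 * trace (A ** B ** A ** B)
    + 2 * (trace (A ** B))\<^sup>2 + 2 / n * (trace (A ** A) * (trace B)\<^sup>2 + trace (B ** B) * (trace A)\<^sup>2)
    + 8 / n * trace (A ** B) * trace A * trace B + trace (A ** A) * trace (B ** B)
    + (3 * n - 6) / n\<^sup>2 * (trace A)\<^sup>2 * (trace B)\<^sup>2"
    unfolding n_def B_def quad_moments_explicit quad_moment_4
    unfolding n_def[symmetric] B_def[symmetric] matrix_mul_assoc cyc
    using nz(1) by (simp add: divide_simps power2_eq_square) (simp add: algebra_simps)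
  finally show ?thesis .
qed

lemma Psi_quad_fun_real:
  fixes A :: "complex^'n^'n"
  shows "Psi (quad_fun A) ^ 4 =
        4 * frobenius_norm (A ** A) ^ 2
      + 2 * schatten4_norm A ^ 4
      + 2 * frobenius_norm A ^ 4
      + 4 / real CARD('n) * Re (trace (A ** A) * trace (ctranspose A) ^ 2)
      + 8 / real CARD('n) * frobenius_norm A ^ 2 * cmod (trace A) ^ 2
      + cmod (trace (A ** A)) ^ 2
      + (3 * real CARD('n) - 6) / real CARD('n) ^ 2 * cmod (trace A) ^ 4" (is "_ = ?R")
proof -
  let ?n = "of_nat CARD('n) :: complex"
  have b: "trace (ctranspose A) = cnj (trace A)" by (rule trace_ctranspose)
  have q: "trace (ctranspose A ** ctranspose A) = cnj (trace (A ** A))"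
    by (simp only: trace_ctranspose[symmetric] ctranspose_mult)
  \<comment> \<open>The two conjugate terms with coefficient 2 / n in \<open>Psi_quad_fun\<close>
    combine into the real part with coefficient 4 / n.\<close>
  have re: "2 * complex_of_real (Re x) = x + cnj x" for x by (simp add: complex_eq_iff)
  have R: "complex_of_real ?R = 4 * of_real ((frobenius_norm (A ** A))\<^sup>2) + 2 * of_real (schatten4_norm A ^ 4)
      + 2 * (of_real ((frobenius_norm A)\<^sup>2))\<^sup>2
      + 2 / ?n * (2 * of_real (Re (trace (A ** A) * (trace (ctranspose A))\<^sup>2)))
      + 8 / ?n * of_real ((frobenius_norm A)\<^sup>2) * of_real ((cmod (trace A))\<^sup>2)
      + of_real ((cmod (trace (A ** A)))\<^sup>2)
      + (3 * ?n - 6) / ?n\<^sup>2 * (of_real ((cmod (trace A))\<^sup>2))\<^sup>2"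
    by simp
  have "complex_of_real (Psi (quad_fun A) ^ 4) = complex_of_real ?R"
    unfolding R re frobenius_norm_sq schatten4_norm_power4 complex_norm_square Psi_quad_fun
    by (simp add: b q ctranspose_mult matrix_mul_assoc algebra_simps)
  then show ?thesis by (simp only: of_real_eq_iff)
qed

theorem theorem4p3:
  shows "unitarily_invariant_norm (Psi :: (complex^'n \<Rightarrow> complex) \<Rightarrow> real) \<and>
    weakly_unitarily_invariant_norm (induced_norm Psi :: complex^'n^'n \<Rightarrow> real) \<and>
    (\<forall>A :: complex^'n^'n.
      induced_norm Psi A ^ 4 =
        4 * frobenius_norm (A ** A) ^ 2
      + 2 * schatten4_norm A ^ 4
      + 2 * frobenius_norm A ^ 4
      + 4 / real CARD('n) * Re (trace (A ** A) * trace (ctranspose A) ^ 2)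
      + 8 / real CARD('n) * frobenius_norm A ^ 2 * cmod (trace A) ^ 2
      + cmod (trace (A ** A)) ^ 2
      + (3 * real CARD('n) - 6) / real CARD('n) ^ 2 * cmod (trace A) ^ 4)"
  using unitarily_invariant_norm_Psi weakly_unitarily_invariant_induced_norm[OF unitarily_invariant_norm_Psi]
  by (auto simp: induced_norm_def Psi_quad_fun_real)

end
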